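(* Let $\mathfrak g$ be a complex simple Lie algebra and let $V$ be a finite-dimensional irreducible $\mathfrak g$-module whose highest weight lies in the root lattice of $\mathfrak g$. Then $V\otimes\mathfrak g$ is generated, as a $\mathfrak g$-module, by its $\mathfrak g$-overshears.
   Context: $V\otimes\mathfrak g$ is a $\mathfrak g$-module via $(\rho\otimes\mathrm{ad})(\xi)(v\otimes\eta) = \rho(\xi)v\otimes\eta + v\otimes[\xi,\eta]$, where $\rho$ is the action on $V$. An element $v\otimes\xi$ ($v\in V$, $\xi\in\mathfrak g$) is a $\mathfrak g$-overshear if $\rho(\xi)^2v = 0$. *)

theory Defs
  imports Complex_Main "HOL-Library.Function_Algebras"
begin

text \<open>Complex vector spaces are represented by an additive group type together with an
explicit complex scalar multiplication (library locale vector_space).\<close>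

definition fin_dim :: "(complex \<Rightarrow> 'a::ab_group_add \<Rightarrow> 'a) \<Rightarrow> bool" where
  "fin_dim s \<longleftrightarrow> vector_space s \<and> (\<exists>B. finite B \<and> module.span s B = UNIV)"

definition lie_algebra :: "(complex \<Rightarrow> 'g::ab_group_add \<Rightarrow> 'g) \<Rightarrow> ('g \<Rightarrow> 'g \<Rightarrow> 'g) \<Rightarrow> bool" where
  "lie_algebra s br \<longleftrightarrow> vector_space s
     \<and> (\<forall>x. Vector_Spaces.linear s s (br x)) \<and> (\<forall>y. Vector_Spaces.linear s s (\<lambda>x. br x y))
     \<and> (\<forall>x. br x x = 0)
     \<and> (\<forall>x y z. br x (br y z) + br y (br z x) + br z (br x y) = 0)"

definition lie_ideal :: "(complex \<Rightarrow> 'g::ab_group_add \<Rightarrow> 'g) \<Rightarrow> ('g \<Rightarrow> 'g \<Rightarrow> 'g) \<Rightarrow> 'g set \<Rightarrow> bool" where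
  "lie_ideal s br I \<longleftrightarrow> module.subspace s I \<and> (\<forall>x. \<forall>y\<in>I. br x y \<in> I)"

definition simple_lie_algebra :: "(complex \<Rightarrow> 'g::ab_group_add \<Rightarrow> 'g) \<Rightarrow> ('g \<Rightarrow> 'g \<Rightarrow> 'g) \<Rightarrow> bool" where
  "simple_lie_algebra s br \<longleftrightarrow> lie_algebra s br \<and> (\<exists>x y. br x y \<noteq> 0)
     \<and> (\<forall>I. lie_ideal s br I \<longrightarrow> I = {0} \<or> I = UNIV)"

definition lie_module :: "(complex \<Rightarrow> 'g::ab_group_add \<Rightarrow> 'g) \<Rightarrow> ('g \<Rightarrow> 'g \<Rightarrow> 'g)
    \<Rightarrow> (complex \<Rightarrow> 'v::ab_group_add \<Rightarrow> 'v) \<Rightarrow> ('g \<Rightarrow> 'v \<Rightarrow> 'v) \<Rightarrow> bool" where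
  "lie_module sg br sv rho \<longleftrightarrow> vector_space sv
     \<and> (\<forall>x. Vector_Spaces.linear sv sv (rho x)) \<and> (\<forall>v. Vector_Spaces.linear sg sv (\<lambda>x. rho x v))
     \<and> (\<forall>x y v. rho (br x y) v = rho x (rho y v) - rho y (rho x v))"

definition invariant_subspace :: "(complex \<Rightarrow> 'v::ab_group_add \<Rightarrow> 'v) \<Rightarrow> ('g \<Rightarrow> 'v \<Rightarrow> 'v) \<Rightarrow> 'v set \<Rightarrow> bool" where
  "invariant_subspace sv rho U \<longleftrightarrow> module.subspace sv U \<and> (\<forall>x. \<forall>u\<in>U. rho x u \<in> U)"

definition irreducible_module :: "(complex \<Rightarrow> 'v::ab_group_add \<Rightarrow> 'v) \<Rightarrow> ('g \<Rightarrow> 'v \<Rightarrow> 'v) \<Rightarrow> bool" where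
  "irreducible_module sv rho \<longleftrightarrow> (UNIV :: 'v set) \<noteq> {0}
     \<and> (\<forall>U. invariant_subspace sv rho U \<longrightarrow> U = {0} \<or> U = UNIV)"

definition gen_submodule :: "(complex \<Rightarrow> 'w::ab_group_add \<Rightarrow> 'w) \<Rightarrow> ('g \<Rightarrow> 'w \<Rightarrow> 'w) \<Rightarrow> 'w set \<Rightarrow> 'w set" where
  "gen_submodule sw sigma S = \<Inter>{U. invariant_subspace sw sigma U \<and> S \<subseteq> U}"

text \<open>Cartan subalgebra of a (semisimple) complex Lie algebra: a maximal toral subalgebra,
 i.e. maximal among abelian subalgebras consisting of ad-semisimple elements.\<close>
definition ad_semisimple :: "(complex \<Rightarrow> 'g::ab_group_add \<Rightarrow> 'g) \<Rightarrow> ('g \<Rightarrow> 'g \<Rightarrow> 'g) \<Rightarrow> 'g \<Rightarrow> bool" where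
  "ad_semisimple s br x \<longleftrightarrow> module.span s {y. \<exists>c. br x y = s c y} = UNIV"

definition toral :: "(complex \<Rightarrow> 'g::ab_group_add \<Rightarrow> 'g) \<Rightarrow> ('g \<Rightarrow> 'g \<Rightarrow> 'g) \<Rightarrow> 'g set \<Rightarrow> bool" where
  "toral s br T \<longleftrightarrow> module.subspace s T \<and> (\<forall>x\<in>T. \<forall>y\<in>T. br x y = 0)
     \<and> (\<forall>x\<in>T. ad_semisimple s br x)"

definition cartan_subalgebra :: "(complex \<Rightarrow> 'g::ab_group_add \<Rightarrow> 'g) \<Rightarrow> ('g \<Rightarrow> 'g \<Rightarrow> 'g) \<Rightarrow> 'g set \<Rightarrow> bool" where
  "cartan_subalgebra s br H \<longleftrightarrow> toral s br H \<and> (\<forall>T. toral s br T \<and> H \<subseteq> T \<longrightarrow> T = H)"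

text \<open>Functionals on H are represented as functions 'g => complex vanishing outside H.\<close>
definition roots :: "(complex \<Rightarrow> 'g::ab_group_add \<Rightarrow> 'g) \<Rightarrow> ('g \<Rightarrow> 'g \<Rightarrow> 'g) \<Rightarrow> 'g set \<Rightarrow> ('g \<Rightarrow> complex) set" where
  "roots s br H = {\<alpha>. (\<forall>x. x \<notin> H \<longrightarrow> \<alpha> x = 0) \<and> (\<exists>h\<in>H. \<alpha> h \<noteq> 0)
     \<and> (\<exists>x. x \<noteq> 0 \<and> (\<forall>h\<in>H. br h x = s (\<alpha> h) x))}"

definition weights :: "'g set \<Rightarrow> (complex \<Rightarrow> 'v::ab_group_add \<Rightarrow> 'v) \<Rightarrow> ('g \<Rightarrow> 'v \<Rightarrow> 'v) \<Rightarrow> ('g \<Rightarrow> complex) set" where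
  "weights H sv rho = {\<mu>. (\<forall>x. x \<notin> H \<longrightarrow> \<mu> x = 0)
     \<and> (\<exists>v. v \<noteq> 0 \<and> (\<forall>h\<in>H. rho h v = sv (\<mu> h) v))}"

definition nat_comb :: "('g \<Rightarrow> complex) set \<Rightarrow> (('g \<Rightarrow> complex) \<Rightarrow> nat) \<Rightarrow> 'g \<Rightarrow> complex" where
  "nat_comb D c = (\<lambda>x. \<Sum>\<delta>\<in>D. of_nat (c \<delta>) * \<delta> x)"

definition root_base :: "(complex \<Rightarrow> 'g::ab_group_add \<Rightarrow> 'g) \<Rightarrow> ('g \<Rightarrow> 'g \<Rightarrow> 'g) \<Rightarrow> 'g set
    \<Rightarrow> ('g \<Rightarrow> complex) set \<Rightarrow> bool" where
  "root_base s br H \<Delta> \<longleftrightarrow> finite \<Delta> \<and> \<Delta> \<subseteq> roots s br H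
     \<and> \<not> module.dependent (\<lambda>(c::complex) (f::'g \<Rightarrow> complex) x. c * f x) \<Delta>
     \<and> (\<forall>\<alpha>\<in>roots s br H. \<exists>c. \<alpha> = nat_comb \<Delta> c \<or> \<alpha> = (\<lambda>x. - nat_comb \<Delta> c x))"

definition positive_roots :: "(complex \<Rightarrow> 'g::ab_group_add \<Rightarrow> 'g) \<Rightarrow> ('g \<Rightarrow> 'g \<Rightarrow> 'g) \<Rightarrow> 'g set
    \<Rightarrow> ('g \<Rightarrow> complex) set \<Rightarrow> ('g \<Rightarrow> complex) set" where
  "positive_roots s br H \<Delta> = {\<alpha>\<in>roots s br H. \<exists>c. \<alpha> = nat_comb \<Delta> c}"

definition highest_weight :: "(complex \<Rightarrow> 'g::ab_group_add \<Rightarrow> 'g) \<Rightarrow> ('g \<Rightarrow> 'g \<Rightarrow> 'g) \<Rightarrow> 'g set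
    \<Rightarrow> ('g \<Rightarrow> complex) set \<Rightarrow> (complex \<Rightarrow> 'v::ab_group_add \<Rightarrow> 'v) \<Rightarrow> ('g \<Rightarrow> 'v \<Rightarrow> 'v)
    \<Rightarrow> ('g \<Rightarrow> complex) \<Rightarrow> bool" where
  "highest_weight s br H \<Delta> sv rho \<mu> \<longleftrightarrow> \<mu> \<in> weights H sv rho
     \<and> (\<forall>\<alpha>\<in>positive_roots s br H \<Delta>. (\<lambda>x. \<mu> x + \<alpha> x) \<notin> weights H sv rho)"

definition root_lattice :: "(complex \<Rightarrow> 'g::ab_group_add \<Rightarrow> 'g) \<Rightarrow> ('g \<Rightarrow> 'g \<Rightarrow> 'g) \<Rightarrow> 'g set
    \<Rightarrow> ('g \<Rightarrow> complex) set" where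
  "root_lattice s br H = {\<mu>. \<exists>c :: ('g \<Rightarrow> complex) \<Rightarrow> int.
     \<mu> = (\<lambda>x. \<Sum>\<alpha>\<in>roots s br H. of_int (c \<alpha>) * \<alpha> x)}"

text \<open>Tensor product of finite-dimensional spaces V and W realised in a space T with the
 bilinear map tp: tp is bilinear, its image spans T, and dim T = dim V * dim W.\<close>
definition tensor_product :: "(complex \<Rightarrow> 'v::ab_group_add \<Rightarrow> 'v) \<Rightarrow> (complex \<Rightarrow> 'g::ab_group_add \<Rightarrow> 'g)
    \<Rightarrow> (complex \<Rightarrow> 't::ab_group_add \<Rightarrow> 't) \<Rightarrow> ('v \<Rightarrow> 'g \<Rightarrow> 't) \<Rightarrow> bool" where
  "tensor_product sv sg st tp \<longleftrightarrow> vector_space st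
     \<and> (\<forall>v. Vector_Spaces.linear sg st (tp v)) \<and> (\<forall>x. Vector_Spaces.linear sv st (\<lambda>v. tp v x))
     \<and> module.span st {tp v x | v x. True} = UNIV
     \<and> vector_space.dim st (UNIV :: 't set)
         = vector_space.dim sv (UNIV :: 'v set) * vector_space.dim sg (UNIV :: 'g set)"

end

theory Submission
  imports Defs "HOL-Computational_Algebra.Fundamental_Theorem_Algebra"
begin

text \<open>
  For an \<open>sl\<^sub>2\<close>-triple \<open>(e, f, h)\<close> and \<open>h v = 2 v\<close>, a computation in \<open>V \<otimes> sl\<^sub>2\<close> with the
  overshears \<open>u \<otimes> e\<close>, \<open>f u \<otimes> e\<close> (\<open>e u = 0\<close>) and \<open>w \<otimes> h\<close> (\<open>h w = 0\<close>) shows that \<open>v \<otimes> f\<close>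
  lies in the submodule \<open>U\<close> generated by the overshears. As every root vector lies in such a triple
  and the centralizer of the Cartan subalgebra \<open>H\<close> is \<open>H\<close>, the zero weight space of \<open>V \<otimes> g\<close> lies
  in \<open>U\<close>. All weights of \<open>V \<otimes> g\<close> are sums of roots. If \<open>\<nu> = \<beta>\<^sub>1 + \<dots> + \<beta>\<^sub>r\<close> is nonzero,
  positivity of the Killing form on the real span of the coroots makes \<open>\<nu>\<close> positive on the coroot of
  some \<open>\<beta>\<^sub>i\<close>; then lowering by \<open>\<beta>\<^sub>i\<close> is injective modulo \<open>U\<close> on the weight space of \<open>\<nu>\<close>, and
  induction on \<open>r\<close> puts every weight space into \<open>U\<close>.

  The Killing form is nondegenerate since otherwise it vanishes, and pairing \<open>ad x\<close> with the
  derivation acting by the conjugate eigenvalues of \<open>ad x\<close> shows that every \<open>ad x\<close> is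
  nilpotent, contradicting Engel's theorem.
\<close>

section \<open>Linear operators\<close>

lemma linear_span_into_subspace:
  assumes "Vector_Spaces.linear s1 s2 f" "module.subspace s2 U"
    and "\<And>x. x \<in> A \<Longrightarrow> f x \<in> U" "x \<in> module.span s1 A"
  shows "f x \<in> U"
proof -
  interpret Vector_Spaces.linear s1 s2 f by fact
  have "vs1.span A \<subseteq> {x. f x \<in> U}"
    using assms(2,3) by (intro vs1.span_minimal subspace_linear_preimage) auto
  with assms(4) show ?thesis by blast
qed

lemma bilinear_span_into_subspace:
  assumes "\<And>x. Vector_Spaces.linear s2 s3 (f x)" "\<And>y. Vector_Spaces.linear s1 s3 (\<lambda>x. f x y)"
    and "module.subspace s3 U"
    and "\<And>x y. x \<in> A \<Longrightarrow> y \<in> B \<Longrightarrow> f x y \<in> U"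
    and "x \<in> module.span s1 A" "y \<in> module.span s2 B"
  shows "f x y \<in> U"
  by (intro linear_span_into_subspace[where f = "\<lambda>x. f x y" and x = x, OF assms(2,3) _ assms(5)]
      linear_span_into_subspace[where f = "f _" and x = y, OF assms(1,3) _ assms(6)] assms(4))

locale linear_operators = vector_space scale
  for scale :: "'f::field \<Rightarrow> 'a::ab_group_add \<Rightarrow> 'a" (infixr \<open>*s\<close> 75)
begin

abbreviation lin :: "('a \<Rightarrow> 'a) \<Rightarrow> bool" where
  "lin f \<equiv> Vector_Spaces.linear scale scale f"

sublocale endo: vector_space_pair scale scale ..

lemma lin_compose: "lin f \<Longrightarrow> lin g \<Longrightarrow> lin (\<lambda>x. f (g x))"
  using Vector_Spaces.linear_compose[of scale scale g scale f] by (simp add: o_def)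

lemma lin_funpow: "lin f \<Longrightarrow> lin (f ^^ k)"
  by (induction k) (simp_all add: linear_id lin_compose o_def)

lemmas lin_intros = linear_scale_self endo.linear_compose_add endo.linear_compose_sub
  endo.linear_compose_scale_right

lemma exists_projection:
  assumes "subspace W"
  obtains P where "lin P" "\<And>v. P v \<in> W" "\<And>w. w \<in> W \<Longrightarrow> P w = w"
proof -
  obtain B where B: "B \<subseteq> W" "independent B" "W \<subseteq> span B"
    using maximal_independent_subset by blast
  obtain P where P: "lin P" "\<forall>b\<in>B. P b = b" "range P = span ((\<lambda>b. b) ` B)"
    using endo.linear_independent_extend_subspace[OF B(2), of "\<lambda>b. b"] by blast
  show ?thesis
  proof (rule that[OF P(1)])
    show "P v \<in> W" for v
      using P(3) span_minimal[OF B(1) assms] by auto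
    show "P w = w" if "w \<in> W" for w
      using endo.linear_eq_on[OF P(1) linear_ident, of w B] P(2) B(3) that by blast
  qed
qed

subsection \<open>Generalised kernels and eigenspaces\<close>

definition gen_kernel :: "('a \<Rightarrow> 'a) \<Rightarrow> 'a set" where
  "gen_kernel A = {v. \<exists>k. (A ^^ k) v = 0}"

lemma gen_kernel_induct [consumes 1, case_names zero step]:
  assumes "v \<in> gen_kernel A" and zero: "P 0"
    and step: "\<And>v. v \<in> gen_kernel A \<Longrightarrow> P (A v) \<Longrightarrow> P v"
  shows "P v"
proof -
  obtain k where "(A ^^ k) v = 0" using assms(1) unfolding gen_kernel_def by blast
  then show ?thesis
  proof (induction k arbitrary: v)
    case 0
    then show ?case using zero by simp
  next
    case (Suc k)
    show ?case
    proof (rule step)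
      show "v \<in> gen_kernel A" using Suc.prems unfolding gen_kernel_def by blast
      show "P (A v)" using Suc.prems by (intro Suc.IH) (simp add: funpow_swap1)
    qed
  qed
qed

lemma zero_in_gen_kernel: "0 \<in> gen_kernel A"
  unfolding gen_kernel_def by (auto intro: exI[of _ 0])

lemma image_in_gen_kernel_iff:
  assumes "lin A"
  shows "A v \<in> gen_kernel A \<longleftrightarrow> v \<in> gen_kernel A"
proof
  assume "A v \<in> gen_kernel A"
  then obtain k where "(A ^^ Suc k) v = 0" unfolding gen_kernel_def by (auto simp: funpow_swap1)
  then show "v \<in> gen_kernel A" unfolding gen_kernel_def by blast
next
  assume "v \<in> gen_kernel A"
  then obtain k where "(A ^^ k) v = 0" unfolding gen_kernel_def by blast
  then have "(A ^^ k) (A v) = 0" by (simp add: funpow_swap1[symmetric] endo.linear_0[OF assms])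
  then show "A v \<in> gen_kernel A" unfolding gen_kernel_def by blast
qed

lemma subspace_gen_kernel:
  assumes A: "lin A"
  shows "subspace (gen_kernel A)"
proof (rule subspaceI)
  show "0 \<in> gen_kernel A" by (rule zero_in_gen_kernel)
  show "x + y \<in> gen_kernel A" if "x \<in> gen_kernel A" "y \<in> gen_kernel A" for x y
    using that
  proof (induction arbitrary: y rule: gen_kernel_induct)
    case (step x)
    then have "A x + A y \<in> gen_kernel A" by (simp add: image_in_gen_kernel_iff[OF A])
    then show ?case by (simp add: endo.linear_add[OF A, symmetric] image_in_gen_kernel_iff[OF A])
  qed simp
  show "c *s x \<in> gen_kernel A" if "x \<in> gen_kernel A" for c x
    using that
  proof (induction rule: gen_kernel_induct)
    case (step x)
    then show ?case by (simp add: endo.linear_scale[OF A, symmetric] image_in_gen_kernel_iff[OF A])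
  qed (simp add: zero_in_gen_kernel)
qed

lemma gen_kernel_commute:
  assumes A: "lin A" and "lin C" and comm: "\<And>x. C (A x) = A (C x)" and "v \<in> gen_kernel A"
  shows "C v \<in> gen_kernel A"
  using assms(4)
proof (induction rule: gen_kernel_induct)
  case zero
  then show ?case by (simp add: endo.linear_0[OF assms(2)] zero_in_gen_kernel)
next
  case (step v)
  then show ?case by (simp add: comm image_in_gen_kernel_iff[OF A])
qed

lemma gen_kernel_last_outside:
  assumes "v \<in> gen_kernel A" "v \<notin> W" "0 \<in> W"
  obtains k where "(A ^^ k) v \<notin> W" "A ((A ^^ k) v) \<in> W"
proof -
  have "\<exists>k. (A ^^ k) v \<notin> W \<and> A ((A ^^ k) v) \<in> W"
    using assms(1,2)
  proof (induction rule: gen_kernel_induct)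
    case (step v)
    show ?case
    proof (cases "A v \<in> W")
      case True
      then show ?thesis using step.prems by (intro exI[of _ 0]) simp
    next
      case False
      then obtain k where "(A ^^ k) (A v) \<notin> W" "A ((A ^^ k) (A v)) \<in> W" using step.IH by blast
      then show ?thesis by (intro exI[of _ "Suc k"]) (simp add: funpow_swap1)
    qed
  qed (use assms(3) in blast)
  then show ?thesis using that by blast
qed

definition locally_nilpotent :: "('a \<Rightarrow> 'a) \<Rightarrow> bool" where
  "locally_nilpotent A \<longleftrightarrow> gen_kernel A = UNIV"

lemma locally_nilpotent_compose_commuting:
  assumes N: "lin N" "locally_nilpotent N" and X: "lin X" and comm: "\<And>x. X (N x) = N (X x)"
  shows "locally_nilpotent (\<lambda>x. X (N x))"
proof -
  have "v \<in> gen_kernel (\<lambda>x. X (N x))" if "v \<in> gen_kernel N" for v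
    using that
  proof (induction rule: gen_kernel_induct)
    case (step v)
    have "X (N v) \<in> gen_kernel (\<lambda>x. X (N x))"
      by (rule gen_kernel_commute[OF lin_compose[OF X N(1)] X _ step.IH]) (simp add: comm)
    then show ?case using image_in_gen_kernel_iff[OF lin_compose[OF X N(1)]] by blast
  qed (rule zero_in_gen_kernel)
  then show ?thesis using N(2) unfolding locally_nilpotent_def by blast
qed

definition gen_eigenspace :: "('a \<Rightarrow> 'a) \<Rightarrow> 'f \<Rightarrow> 'a set" where
  "gen_eigenspace A c = gen_kernel (\<lambda>x. A x - c *s x)"

lemma lin_shift: "lin A \<Longrightarrow> lin (\<lambda>x. A x - c *s x)"
  by (intro lin_intros)

lemma gen_eigenspace_zero [simp]: "gen_eigenspace A 0 = gen_kernel A"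
  by (simp add: gen_eigenspace_def)

lemmas gen_eigenspace_induct [consumes 1, case_names zero step] =
  gen_kernel_induct[of _ "\<lambda>x. A x - c *s x" for A c, folded gen_eigenspace_def]
  and zero_in_gen_eigenspace =
  zero_in_gen_kernel[of "\<lambda>x. A x - c *s x" for A c, folded gen_eigenspace_def]
  and subspace_gen_eigenspace = subspace_gen_kernel[OF lin_shift, folded gen_eigenspace_def]
  and shift_in_gen_eigenspace_iff = image_in_gen_kernel_iff[OF lin_shift, folded gen_eigenspace_def]

lemma eigenvector_in_gen_eigenspace: "lin A \<Longrightarrow> A v = c *s v \<Longrightarrow> v \<in> gen_eigenspace A c"
  using shift_in_gen_eigenspace_iff[of A v c] by (simp add: zero_in_gen_eigenspace)

lemma gen_eigenspace_commute:
  assumes "lin A" "lin C" "\<And>x. C (A x) = A (C x)" "v \<in> gen_eigenspace A c"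
  shows "C v \<in> gen_eigenspace A c"
  unfolding gen_eigenspace_def
proof (rule gen_kernel_commute[OF lin_shift[OF assms(1)] assms(2)])
  show "C (A x - c *s x) = A (C x) - c *s C x" for x
    by (simp only: endo.linear_diff[OF assms(2)] endo.linear_scale[OF assms(2)] assms(3))
qed (use assms(4) in \<open>simp add: gen_eigenspace_def\<close>)

lemma gen_eigenspace_shift:
  assumes "lin A" "v \<in> gen_eigenspace A c"
  shows "A v - d *s v \<in> gen_eigenspace A c"
  by (rule gen_eigenspace_commute[OF assms(1) lin_shift[OF assms(1)] _ assms(2)])
     (simp add: endo.linear_diff[OF assms(1)] endo.linear_scale[OF assms(1)])

lemma gen_eigenspace_disjoint:
  assumes A: "lin A" and "c \<noteq> d" "v \<in> gen_eigenspace A c" "v \<in> gen_eigenspace A d"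
  shows "v = 0"
proof -
  have eigenvector_zero: "v = 0" if "v \<in> gen_eigenspace A d" "A v = c *s v" for v
    using that
  proof (induction rule: gen_eigenspace_induct)
    case (step v)
    have "A v - d *s v = (c - d) *s v" using step.prems by (simp add: scale_left_diff_distrib)
    then have "(c - d) *s v = 0"
      using step by (simp add: endo.linear_scale[OF A] mult.commute)
    then show ?case using \<open>c \<noteq> d\<close> by simp
  qed simp
  show ?thesis using assms(3,4)
  proof (induction rule: gen_eigenspace_induct)
    case (step v)
    then have "A v - c *s v = 0" using gen_eigenspace_shift[OF A] by blast
    then show ?case using eigenvector_zero step.prems by simp
  qed simp
qed

lemma gen_eigenspace_independent:
  assumes A: "lin A" and "finite I" "inj_on c I" "\<And>i. i \<in> I \<Longrightarrow> u i \<in> gen_eigenspace A (c i)"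
    and "(\<Sum>i\<in>I. u i) = 0" and "i \<in> I"
  shows "u i = 0"
proof -
  have "\<forall>i\<in>I. u i = 0"
    using assms(2-5)
  proof (induction I arbitrary: u rule: finite_induct)
    case (insert j I)
    have others: "\<forall>i\<in>I. u i = 0" if "w \<in> gen_eigenspace A (c j)"
      "\<And>i. i \<in> I \<Longrightarrow> u i \<in> gen_eigenspace A (c i)" "w + (\<Sum>i\<in>I. u i) = 0" for w u
      using that
    proof (induction arbitrary: u rule: gen_eigenspace_induct)
      case zero
      then show ?case using insert.IH insert.prems(1) by simp
    next
      case (step w)
      let ?N = "\<lambda>x. A x - c j *s x"
      have "?N w + (\<Sum>i\<in>I. ?N (u i)) = ?N (w + (\<Sum>i\<in>I. u i))"
        by (simp only: endo.linear_add[OF lin_shift[OF A]] endo.linear_sum[OF lin_shift[OF A]])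
      also have "\<dots> = 0" unfolding step.prems(2) by (simp add: endo.linear_0[OF A])
      finally have "\<forall>i\<in>I. ?N (u i) = 0"
        using step.prems(1) by (intro step.IH gen_eigenspace_shift[OF A]) auto
      then have "u i \<in> gen_eigenspace A (c j)" if "i \<in> I" for i
        using that by (intro eigenvector_in_gen_eigenspace[OF A]) simp
      moreover have "c i \<noteq> c j" if "i \<in> I" for i
        using insert.prems(1) insert.hyps(2) that by (auto simp: inj_on_def)
      ultimately show ?case using gen_eigenspace_disjoint[OF A] step.prems(1) by blast
    qed
    have "\<forall>i\<in>I. u i = 0"
      using insert.prems insert.hyps by (intro others[of "u j"]) auto
    then show ?case using insert.prems(3) insert.hyps by simp
  qed simp
  then show ?thesis using assms(6) by blast
qed

lemma gen_eigenspace_shift_surj: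
  assumes A: "lin A" and W: "subspace W" "\<And>w. w \<in> W \<Longrightarrow> A w \<in> W"
    and "c \<noteq> d" "v \<in> gen_eigenspace A c" "v \<in> W"
  shows "\<exists>u\<in>gen_eigenspace A c \<inter> W. A u - d *s u = v"
  using assms(5,6)
proof (induction rule: gen_eigenspace_induct)
  case zero
  then show ?case using zero_in_gen_eigenspace W(1) subspace_0 endo.linear_0[OF A]
    by (intro bexI[of _ 0]) auto
next
  case (step v)
  have "A v - c *s v \<in> W"
    using step.prems W by (intro subspace_diff subspace_scale) auto
  then obtain u where u: "u \<in> gen_eigenspace A c \<inter> W" "A u - d *s u = A v - c *s v"
    using step.IH by blast
  define w where "w = (1 / (c - d)) *s (v - u)"
  have "A (v - u) - d *s (v - u) = (A v - d *s v) - (A u - d *s u)"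
    by (simp add: endo.linear_diff[OF A] scale_right_diff_distrib)
  also have "\<dots> = (c - d) *s v" unfolding u(2) by (simp add: scale_left_diff_distrib)
  finally have "(1 / (c - d)) *s (A (v - u) - d *s (v - u)) = v" using \<open>c \<noteq> d\<close> by simp
  moreover have "A w - d *s w = (1 / (c - d)) *s (A (v - u) - d *s (v - u))"
    unfolding w_def endo.linear_scale[OF A] by (simp add: scale_right_diff_distrib mult.commute)
  ultimately have "A w - d *s w = v" by simp
  moreover have "w \<in> gen_eigenspace A c \<inter> W"
    using u(1) step.prems step.hyps W(1) subspace_gen_eigenspace[OF A] unfolding w_def
    by (auto intro!: subspace_scale subspace_diff)
  ultimately show ?case by blast
qed

lemma span_gen_eigenspaces_shift_surj_mod:
  assumes A: "lin A" and W: "subspace W" "\<And>w. w \<in> W \<Longrightarrow> A w \<in> W"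
    and "s \<in> span (\<Union>c. gen_eigenspace A c \<inter> W)"
  shows "\<exists>w\<in>span (\<Union>c. gen_eigenspace A c \<inter> W). s - (A w - d *s w) \<in> gen_eigenspace A d"
    (is "\<exists>w\<in>?S. _")
  using assms(4)
proof (induction rule: span_induct_alt)
  case base
  show ?case
    using span_zero zero_in_gen_eigenspace by (intro bexI[of _ 0]) (auto simp: endo.linear_0[OF A])
next
  case (step a x s)
  obtain w where w: "w \<in> ?S" "s - (A w - d *s w) \<in> gen_eigenspace A d" using step.IH by blast
  have "\<exists>u\<in>?S. x - (A u - d *s u) \<in> gen_eigenspace A d"
  proof (cases "x \<in> gen_eigenspace A d")
    case True
    then show ?thesis using span_zero by (intro bexI[of _ 0]) (auto simp: endo.linear_0[OF A])
  next
    case False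
    then obtain c where "x \<in> gen_eigenspace A c" "x \<in> W" "c \<noteq> d" using step.hyps by blast
    then obtain u where "u \<in> gen_eigenspace A c \<inter> W" "A u - d *s u = x"
      using gen_eigenspace_shift_surj[OF A W] by blast
    then show ?thesis using zero_in_gen_eigenspace by (intro bexI[of _ u] span_base) auto
  qed
  then obtain u where u: "u \<in> ?S" "x - (A u - d *s u) \<in> gen_eigenspace A d" by blast
  have "a *s (x - (A u - d *s u)) + (s - (A w - d *s w)) \<in> gen_eigenspace A d"
    using u(2) w(2) subspace_gen_eigenspace[OF A] by (intro subspace_add subspace_scale) auto
  also have "a *s (x - (A u - d *s u)) + (s - (A w - d *s w))
      = (a *s x + s) - (A (a *s u + w) - d *s (a *s u + w))"
    by (simp add: endo.linear_add[OF A] endo.linear_scale[OF A] mult.commute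
        scale_right_distrib scale_right_diff_distrib)
  finally show ?case using u(1) w(1) by (intro bexI[of _ "a *s u + w"] span_add span_scale) auto
qed

lemma span_gen_eigenspaces_shiftD:
  assumes A: "lin A" and W: "subspace W" "\<And>w. w \<in> W \<Longrightarrow> A w \<in> W"
    and v: "v \<in> W" "A v - d *s v \<in> span (\<Union>c. gen_eigenspace A c \<inter> W)"
  shows "v \<in> span (\<Union>c. gen_eigenspace A c \<inter> W)" (is "_ \<in> ?S")
proof -
  obtain w where w: "w \<in> ?S" "(A v - d *s v) - (A w - d *s w) \<in> gen_eigenspace A d"
    using span_gen_eigenspaces_shift_surj_mod[OF A W v(2)] by blast
  then have "A (v - w) - d *s (v - w) \<in> gen_eigenspace A d"
    by (simp add: endo.linear_diff[OF A] scale_right_diff_distrib algebra_simps)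
  then have "v - w \<in> gen_eigenspace A d" by (simp add: shift_in_gen_eigenspace_iff[OF A])
  moreover have "?S \<subseteq> W" by (intro span_minimal W(1)) blast
  then have "v - w \<in> W" using v(1) w(1) W(1) by (intro subspace_diff) auto
  ultimately have "v - w \<in> ?S" by (intro span_base) blast
  then show ?thesis using span_add[OF _ w(1), of "v - w"] by simp
qed

definition poly_op :: "('a \<Rightarrow> 'a) \<Rightarrow> 'f poly \<Rightarrow> 'a \<Rightarrow> 'a" where
  "poly_op A p v = (\<Sum>i\<le>degree p. coeff p i *s (A ^^ i) v)"

lemma poly_op_altdef: "degree p \<le> n \<Longrightarrow> poly_op A p v = (\<Sum>i\<le>n. coeff p i *s (A ^^ i) v)"
  unfolding poly_op_def by (intro sum.mono_neutral_left) (auto simp: coeff_eq_0)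

lemma poly_op_linear_factor:
  assumes A: "lin A"
  shows "poly_op A ([:- c, 1:] * q) v = poly_op A q (A v - c *s v)"
proof -
  let ?n = "Suc (degree q)"
  have "[:- c, 1:] * q = pCons 0 q - smult c q" by simp
  moreover have "degree (pCons 0 q - smult c q) \<le> ?n"
    by (intro degree_diff_le) (auto intro: order_trans[OF degree_smult_le])
  ultimately have "poly_op A ([:- c, 1:] * q) v
      = (\<Sum>i\<le>?n. coeff (pCons 0 q - smult c q) i *s (A ^^ i) v)"
    using poly_op_altdef by metis
  also have "\<dots> = (\<Sum>i\<le>?n. coeff (pCons 0 q) i *s (A ^^ i) v)
      - (\<Sum>i\<le>?n. (c * coeff q i) *s (A ^^ i) v)"
    by (simp add: scale_left_diff_distrib sum_subtractf)
  also have "(\<Sum>i\<le>?n. coeff (pCons 0 q) i *s (A ^^ i) v)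
      = (\<Sum>i\<le>degree q. coeff q i *s (A ^^ i) (A v))"
    by (subst sum.atMost_Suc_shift) (simp add: funpow_swap1)
  also have "(\<Sum>i\<le>?n. (c * coeff q i) *s (A ^^ i) v)
      = (\<Sum>i\<le>degree q. coeff q i *s (A ^^ i) (c *s v))"
    by (simp add: coeff_eq_0 endo.linear_scale[OF lin_funpow[OF A]] mult.commute)
  finally show ?thesis
    unfolding poly_op_def
    by (simp add: endo.linear_diff[OF lin_funpow[OF A]] scale_right_diff_distrib sum_subtractf)
qed

end

subsection \<open>The trace\<close>

locale fd_linear_operators = linear_operators scale + finite_dimensional_vector_space scale Basis
  for scale :: "'f::field \<Rightarrow> 'a::ab_group_add \<Rightarrow> 'a" (infixr \<open>*s\<close> 75) and Basis :: "'a set"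
begin

lemma basis_within:
  assumes "span S = UNIV"
  obtains B where "B \<subseteq> S" "independent B" "span B = UNIV" "finite B"
proof -
  obtain B where B: "B \<subseteq> S" "independent B" "S \<subseteq> span B"
    using maximal_independent_subset by blast
  then have "span B = UNIV" using assms span_eq[of B S] span_superset by blast
  then show ?thesis using that B finiteI_independent by blast
qed

lemma subspace_dim_psubset: "subspace S \<Longrightarrow> subspace T \<Longrightarrow> S \<subset> T \<Longrightarrow> dim S < dim T"
  by (metis dim_psubset span_eq_iff)

lemma nontrivial_relation:
  assumes "dim (UNIV :: 'a set) \<le> n"
  obtains r i where "i \<le> n" "r i \<noteq> 0" "(\<Sum>k\<le>n. r k *s u k) = 0"
proof (cases "inj_on u {..n}")
  case False
  then obtain i j where ij: "i \<le> n" "j \<le> n" "i \<noteq> j" "u i = u j" by (auto simp: inj_on_def)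
  have "(\<Sum>k\<le>n. (if k = i then 1 else if k = j then - 1 else 0) *s u k)
      = (\<Sum>k\<le>n. (if k = i then u i else 0) - (if k = j then u j else 0))"
    using ij(3) by (intro sum.cong) auto
  also have "\<dots> = 0" using ij by (simp add: sum_subtractf)
  finally show ?thesis
    using that[of i "\<lambda>k. if k = i then 1 else if k = j then - 1 else 0"] ij(1) by simp
next
  case True
  have "dim (u ` {..n}) \<le> n" using dim_subset[of "u ` {..n}" UNIV] assms by simp
  then have "dependent (u ` {..n})"
    using True by (intro dependent_biggerset_general) (simp add: card_image)
  then obtain r i where "(\<Sum>v\<in>u ` {..n}. r v *s v) = 0" "i \<le> n" "r (u i) \<noteq> 0"
    using dependent_finite[of "u ` {..n}"] by auto
  then show ?thesis using that[of i "\<lambda>k. r (u k)"] True by (simp add: sum.reindex)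
qed

lemma poly_op_annihilates:
  obtains p where "p \<noteq> 0" "poly_op A p v = 0"
proof -
  define n where "n = dim (UNIV :: 'a set)"
  obtain r i where r: "i \<le> n" "r i \<noteq> 0" "(\<Sum>k\<le>n. r k *s (A ^^ k) v) = 0"
    using nontrivial_relation[of n "\<lambda>k. (A ^^ k) v"] unfolding n_def by blast
  define p where "p = (\<Sum>k\<le>n. monom (r k) k)"
  have coeff: "coeff p k = (if k \<le> n then r k else 0)" for k
    unfolding p_def by (simp add: coeff_sum if_distrib cong: if_cong)
  then have "p \<noteq> 0" using r(1,2) by (metis coeff_0)
  moreover have "poly_op A p v = (\<Sum>k\<le>n. coeff p k *s (A ^^ k) v)"
    by (intro poly_op_altdef degree_le) (simp add: coeff)
  then have "poly_op A p v = 0" using r(3) by (simp add: coeff)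
  ultimately show ?thesis by (rule that)
qed

lemma locally_nilpotent_uniform:
  assumes "lin A" "locally_nilpotent A"
  obtains n where "\<And>v. (A ^^ n) v = 0"
proof -
  have "\<forall>v. \<exists>k. (A ^^ k) v = 0"
    using assms(2) unfolding locally_nilpotent_def gen_kernel_def by blast
  then obtain k where k: "\<And>v. (A ^^ k v) v = 0" by metis
  define n where "n = Max (k ` Basis)"
  have "(A ^^ n) b = 0" if "b \<in> Basis" for b
  proof -
    have "k b \<le> n" unfolding n_def using that finite_Basis by (intro Max_ge) auto
    then have "(A ^^ n) b = (A ^^ (n - k b)) ((A ^^ k b) b)"
      by (metis comp_apply funpow_add le_add_diff_inverse2)
    then show ?thesis by (simp add: k endo.linear_0[OF lin_funpow[OF assms(1)]])
  qed
  then have "(A ^^ n) v = 0" for v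
    using endo.linear_eq_on[OF lin_funpow[OF assms(1)] endo.linear_zero, of v Basis n] span_Basis
    by auto
  then show ?thesis by (rule that)
qed

definition trace :: "('a \<Rightarrow> 'a) \<Rightarrow> 'f" where
  "trace A = (\<Sum>b\<in>Basis. representation Basis (A b) b)"

lemma representation_image_eq_sum:
  assumes B: "independent B" "span B = UNIV" and E: "independent E" "span E = UNIV" and A: "lin A"
  shows "representation E (A v) e = (\<Sum>b\<in>B. representation B v b * representation E (A b) e)"
proof -
  have "(\<Sum>b\<in>B. representation B v b *s b) = v"
    using B finiteI_independent by (intro sum_representation_eq) auto
  then have "A v = (\<Sum>b\<in>B. representation B v b *s A b)"
    using endo.linear_sum[OF A, of "\<lambda>b. representation B v b *s b" B]
    by (simp add: endo.linear_scale[OF A])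
  then show ?thesis
    using E by (simp add: representation_sum representation_scale)
qed

lemma sum_diagonal_commute:
  assumes B: "independent B" "span B = UNIV" and E: "independent E" "span E = UNIV"
    and A: "lin A" and C: "lin C"
  shows "(\<Sum>b\<in>B. representation B (A (C b)) b) = (\<Sum>e\<in>E. representation E (C (A e)) e)"
proof -
  have "(\<Sum>b\<in>B. representation B (A (C b)) b)
      = (\<Sum>b\<in>B. \<Sum>e\<in>E. representation E (C b) e * representation B (A e) b)"
    by (intro sum.cong refl representation_image_eq_sum E B A)
  also have "\<dots> = (\<Sum>e\<in>E. \<Sum>b\<in>B. representation B (A e) b * representation E (C b) e)"
    by (subst sum.swap) (simp add: mult.commute)
  also have "\<dots> = (\<Sum>e\<in>E. representation E (C (A e)) e)"
    by (intro sum.cong refl representation_image_eq_sum[symmetric] E B C)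
  finally show ?thesis .
qed

lemma trace_eq_sum_basis:
  assumes "independent B" "span B = UNIV" "lin A"
  shows "trace A = (\<Sum>b\<in>B. representation B (A b) b)"
  unfolding trace_def
  using sum_diagonal_commute[OF independent_Basis span_Basis assms(1,2,3) linear_ident] .

lemma trace_eigenbasis:
  assumes "independent B" "span B = UNIV" "lin A" "\<And>b. b \<in> B \<Longrightarrow> A b = c b *s b"
  shows "trace A = (\<Sum>b\<in>B. c b)"
  unfolding trace_eq_sum_basis[OF assms(1-3)] using assms
  by (intro sum.cong) (auto simp: representation_scale representation_basis)

lemma trace_commute: "lin A \<Longrightarrow> lin C \<Longrightarrow> trace (\<lambda>x. A (C x)) = trace (\<lambda>x. C (A x))"
  unfolding trace_def by (intro sum_diagonal_commute independent_Basis span_Basis)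

lemma trace_add: "trace (\<lambda>x. A x + C x) = trace A + trace C"
  by (simp add: trace_def representation_add independent_Basis span_Basis sum.distrib)

lemma trace_diff: "trace (\<lambda>x. A x - C x) = trace A - trace C"
  by (simp add: trace_def representation_diff independent_Basis span_Basis sum_subtractf)

lemma trace_scale: "trace (\<lambda>x. c *s A x) = c * trace A"
  by (simp add: trace_def representation_scale independent_Basis span_Basis sum_distrib_left)

lemma trace_zero [simp]: "trace (\<lambda>x. 0) = 0"
  using trace_scale[of 0 "\<lambda>x. 0"] by simp

lemma trace_commutator_cyclic:
  assumes A: "lin A" and B: "lin B" and C: "lin C"
  shows "trace (\<lambda>v. A (B (C v)) - B (A (C v))) = trace (\<lambda>v. A (B (C v) - C (B v)))"
proof -
  have "trace (\<lambda>v. B (A (C v))) = trace (\<lambda>v. A (C (B v)))"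
    by (rule trace_commute[OF B lin_compose[OF A C]])
  then show ?thesis by (simp add: endo.linear_diff[OF A] trace_diff)
qed

text \<open>With projections \<open>P k\<close> onto the ranges of \<open>A ^^ k\<close>, cyclicity gives
  \<open>tr (A P\<^sub>k) = tr (P\<^sub>k\<^sub>+\<^sub>1 A P\<^sub>k) = tr (A P\<^sub>k P\<^sub>k\<^sub>+\<^sub>1) = tr (A P\<^sub>k\<^sub>+\<^sub>1)\<close>.\<close>

lemma trace_locally_nilpotent:
  assumes A: "lin A" "locally_nilpotent A"
  shows "trace A = 0"
proof -
  have "subspace (range (A ^^ k))" for k
    by (rule endo.linear_subspace_image[OF lin_funpow[OF A(1)] subspace_UNIV])
  then have "\<forall>k. \<exists>P. lin P \<and> (\<forall>v. P v \<in> range (A ^^ k)) \<and> (\<forall>w\<in>range (A ^^ k). P w = w)"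
    by (metis exists_projection)
  then obtain P where P: "\<And>k. lin (P k)" "\<And>k v. P k v \<in> range (A ^^ k)"
      "\<And>k w. w \<in> range (A ^^ k) \<Longrightarrow> P k w = w"
    by metis
  have trace_P: "trace (\<lambda>v. A (P k v)) = trace A" for k
  proof (induction k)
    case 0
    have "P 0 v = v" for v by (rule P(3)) simp
    then show ?case by simp
  next
    case (Suc k)
    have "A (P k v) \<in> range (A ^^ Suc k)" for v using P(2)[of k v] by auto
    then have "trace (\<lambda>v. A (P k v)) = trace (\<lambda>v. P (Suc k) (A (P k v)))" by (simp add: P(3))
    also have "\<dots> = trace (\<lambda>v. A (P k (P (Suc k) v)))"
      by (rule trace_commute[OF P(1) lin_compose[OF A(1) P(1)]])
    also have "range (A ^^ Suc k) \<subseteq> range (A ^^ k)" unfolding funpow_Suc_right by auto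
    then have "(\<lambda>v. A (P k (P (Suc k) v))) = (\<lambda>v. A (P (Suc k) v))" using P(2,3) by (metis subsetD)
    finally show ?case using Suc.IH by simp
  qed
  obtain n where "\<And>v. (A ^^ n) v = 0" using locally_nilpotent_uniform[OF A] by blast
  then have "P n v = 0" for v using P(2)[of n v] by auto
  then show ?thesis using trace_P[of n] by (simp add: endo.linear_0[OF A(1)])
qed

text \<open>If \<open>\<Phi>\<close> sends \<open>x\<close> to the vector with coordinates \<open>\<beta> x b\<close>, nondegeneracy makes it
  injective, hence surjective.\<close>

lemma nondegenerate_form_represents:
  assumes "\<And>x y z. \<beta> (x + y) z = \<beta> x z + \<beta> y z" "\<And>c x z. \<beta> (c *s x) z = c * \<beta> x z"
    and "\<And>x. Vector_Spaces.linear scale (*) (\<beta> x)" and "\<And>x. (\<And>y. \<beta> x y = 0) \<Longrightarrow> x = 0"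
    and "Vector_Spaces.linear scale (*) \<phi>"
  obtains x where "\<And>y. \<beta> x y = \<phi> y"
proof -
  interpret functional: vector_space_pair scale "(*) :: 'f \<Rightarrow> 'f \<Rightarrow> 'f"
    by unfold_locales (simp_all add: algebra_simps)
  define \<Phi> where "\<Phi> x = (\<Sum>b\<in>Basis. \<beta> x b *s b)" for x
  have repr: "representation Basis (\<Sum>b\<in>Basis. f b *s b) b = f b" if "b \<in> Basis" for f b
    using that independent_Basis finite_Basis
    by (simp add: representation_sum representation_scale span_Basis representation_basis
        if_distrib cong: if_cong)
  have "lin \<Phi>"
    unfolding \<Phi>_def Vector_Spaces.linear_iff using vector_space_axioms
    by (simp add: assms(1,2) scale_left_distrib sum.distrib scale_sum_right)
  moreover have "inj \<Phi>"
  proof (subst endo.linear_inj_iff_eq_0[OF \<open>lin \<Phi>\<close>], intro allI impI)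
    fix x assume "\<Phi> x = 0"
    then have "\<beta> x b = 0" if "b \<in> Basis" for b
      using repr[OF that, of "\<beta> x"] unfolding \<Phi>_def by (simp add: representation_zero)
    then have "\<beta> x y = 0" for y
      using functional.linear_eq_on[OF assms(3) functional.linear_zero, of y Basis x] span_Basis
      by auto
    then show "x = 0" by (rule assms(4))
  qed
  ultimately obtain x where "\<Phi> x = (\<Sum>b\<in>Basis. \<phi> b *s b)"
    using linear_inj_imp_surj by (metis surjD)
  then have "\<beta> x b = \<phi> b" if "b \<in> Basis" for b
    using repr[OF that, of "\<beta> x"] repr[OF that, of \<phi>] unfolding \<Phi>_def by simp
  then show ?thesis
    using that functional.linear_eq_on[OF assms(3,5), of _ Basis x] span_Basis by blast
qed

end

subsection \<open>Functional calculus on generalised eigenspaces\<close>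

locale alg_closed_fd_operators = fd_linear_operators scale Basis
  for scale :: "'f::alg_closed_field \<Rightarrow> 'a::ab_group_add \<Rightarrow> 'a" (infixr \<open>*s\<close> 75) and Basis :: "'a set"
begin

lemma invariant_subspace_gen_eigenspaces:
  assumes A: "lin A" and W: "subspace W" "\<And>w. w \<in> W \<Longrightarrow> A w \<in> W"
  shows "W \<subseteq> span (\<Union>c. gen_eigenspace A c \<inter> W)"
proof
  fix v assume "v \<in> W"
  obtain p where "p \<noteq> 0" "poly_op A p v = 0" by (rule poly_op_annihilates)
  then show "v \<in> span (\<Union>c. gen_eigenspace A c \<inter> W)"
    using \<open>v \<in> W\<close>
  proof (induction "degree p" arbitrary: p v)
    case 0
    then obtain a where "p = [:a:]" by (metis degree_eq_zeroE)
    then have "v = 0" using 0 by (simp add: poly_op_def)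
    then show ?case by (simp add: span_zero)
  next
    case (Suc n)
    then obtain c where "poly p c = 0" using alg_closed_imp_poly_has_root[of p] by auto
    then obtain q where p: "p = [:- c, 1:] * q" unfolding poly_eq_0_iff_dvd by (rule dvdE)
    have "A v - c *s v \<in> span (\<Union>c. gen_eigenspace A c \<inter> W)"
    proof (rule Suc.hyps(1))
      show "q \<noteq> 0" using p Suc.prems(1) by auto
      then show "n = degree q" using Suc.hyps(2) unfolding p by (subst (asm) degree_mult_eq) auto
      show "poly_op A q (A v - c *s v) = 0"
        using Suc.prems(2) unfolding p poly_op_linear_factor[OF A] .
      show "A v - c *s v \<in> W"
        using W Suc.prems(3) by (intro subspace_diff subspace_scale) auto
    qed
    then show ?case using span_gen_eigenspaces_shiftD[OF A W Suc.prems(3)] by blast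
  qed
qed

lemma span_gen_eigenspaces: "lin A \<Longrightarrow> span (\<Union>c. gen_eigenspace A c) = UNIV"
  using invariant_subspace_gen_eigenspaces[of A UNIV] by auto

lemma lin_eqI_gen_eigenspaces:
  assumes "lin A" "lin f" "lin g" "\<And>c v. v \<in> gen_eigenspace A c \<Longrightarrow> f v = g v"
  shows "f = g"
proof
  show "f v = g v" for v
    using endo.linear_eq_on[OF assms(2,3), of v "\<Union>c. gen_eigenspace A c"] assms(4)
      span_gen_eigenspaces[OF assms(1)] by blast
qed

lemma gen_eigenbasis:
  assumes "lin A"
  obtains B e where "independent B" "span B = UNIV" "finite B"
    "\<And>b. b \<in> B \<Longrightarrow> b \<in> gen_eigenspace A (e b)"
proof -
  obtain B where B: "B \<subseteq> (\<Union>c. gen_eigenspace A c)" "independent B" "span B = UNIV" "finite B"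
    using basis_within[OF span_gen_eigenspaces[OF assms]] by blast
  then have "\<exists>c. b \<in> gen_eigenspace A c" if "b \<in> B" for b using that by blast
  then have "\<exists>e. \<forall>b\<in>B. b \<in> gen_eigenspace A (e b)" by metis
  then show ?thesis using that B(2-4) by blast
qed

lemma gen_eigenbasis_part:
  assumes A: "lin A" and B: "independent B" "span B = UNIV" "finite B"
    and e: "\<And>b. b \<in> B \<Longrightarrow> b \<in> gen_eigenspace A (e b)" and v: "v \<in> gen_eigenspace A c"
  shows "(\<Sum>b\<in>{b\<in>B. e b = d}. representation B v b *s b) = (if d = c then v else 0)"
    (is "?part d = _")
proof -
  let ?C = "insert d (insert c (e ` B))"
  note sub = subspace_gen_eigenspace[OF A]
  have "(\<Sum>b\<in>B. representation B v b *s b) = v"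
    using B by (intro sum_representation_eq) auto
  then have sum_parts: "(\<Sum>d\<in>?C. ?part d) = v"
    using sum.group[of B ?C e "\<lambda>b. representation B v b *s b"] B(3) by auto
  have "?part d - (if d = c then v else 0) = 0"
  proof (rule gen_eigenspace_independent[OF A, where I = ?C and c = "\<lambda>d. d"
        and u = "\<lambda>d. ?part d - (if d = c then v else 0)"])
    show "?part d - (if d = c then v else 0) \<in> gen_eigenspace A d" for d
    proof -
      have "?part d \<in> gen_eigenspace A d"
        using e by (intro subspace_sum[OF sub] subspace_scale[OF sub]) auto
      then show ?thesis using v subspace_diff[OF sub] by auto
    qed
    show "(\<Sum>d\<in>?C. ?part d - (if d = c then v else 0)) = 0"
      unfolding sum_subtractf sum_parts using B(3) by simp
  qed (use B(3) in simp_all)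
  then show ?thesis by simp
qed

lemma exists_scalar_on_gen_eigenspaces:
  assumes A: "lin A"
  obtains D where "lin D" "\<And>c v. v \<in> gen_eigenspace A c \<Longrightarrow> D v = f c *s v"
proof -
  obtain B e where B: "independent B" "span B = UNIV" "finite B"
    and e: "\<And>b. b \<in> B \<Longrightarrow> b \<in> gen_eigenspace A (e b)"
    using gen_eigenbasis[OF A] by metis
  obtain D where D: "lin D" "\<forall>b\<in>B. D b = f (e b) *s b"
    using endo.linear_independent_extend[OF B(1), of "\<lambda>b. f (e b) *s b"] by blast
  have "D v = f c *s v" if v: "v \<in> gen_eigenspace A c" for c v
  proof -
    let ?C = "insert c (e ` B)" and ?r = "\<lambda>b. representation B v b *s b"
    have "(\<Sum>b\<in>B. ?r b) = v" using B by (intro sum_representation_eq) auto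
    then have "D v = (\<Sum>b\<in>B. D (?r b))" using endo.linear_sum[OF D(1), of ?r B] by simp
    also have "\<dots> = (\<Sum>b\<in>B. f (e b) *s ?r b)"
      by (intro sum.cong) (simp_all add: endo.linear_scale[OF D(1)] D(2) mult.commute)
    also have "\<dots> = (\<Sum>d\<in>?C. \<Sum>b\<in>{b\<in>B. e b = d}. f (e b) *s ?r b)"
      using B(3) by (intro sum.group[symmetric]) auto
    also have "\<dots> = (\<Sum>d\<in>?C. f d *s (\<Sum>b\<in>{b\<in>B. e b = d}. ?r b))"
      unfolding scale_sum_right by (intro sum.cong) auto
    also have "\<dots> = (\<Sum>d\<in>?C. if d = c then f c *s v else 0)"
      using gen_eigenbasis_part[OF A B _ v] e by (intro sum.cong) auto
    also have "\<dots> = f c *s v" using B(3) by simp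
    finally show ?thesis .
  qed
  then show ?thesis using that D(1) by blast
qed

definition diag_op :: "('f \<Rightarrow> 'f) \<Rightarrow> ('a \<Rightarrow> 'a) \<Rightarrow> 'a \<Rightarrow> 'a" where
  "diag_op f A = (THE D. lin D \<and> (\<forall>c. \<forall>v\<in>gen_eigenspace A c. D v = f c *s v))"

lemma diag_op_eqI:
  assumes "lin A" "lin D" "\<And>c v. v \<in> gen_eigenspace A c \<Longrightarrow> D v = f c *s v"
  shows "diag_op f A = D"
  unfolding diag_op_def
  by (rule the_equality) (use assms lin_eqI_gen_eigenspaces[OF assms(1)] in auto)

lemma lin_diag_op: "lin A \<Longrightarrow> lin (diag_op f A)"
  and diag_op_gen_eigenspace: "lin A \<Longrightarrow> v \<in> gen_eigenspace A c \<Longrightarrow> diag_op f A v = f c *s v"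
  using exists_scalar_on_gen_eigenspaces[of A f] diag_op_eqI by metis+

lemma diag_op_commute:
  assumes A: "lin A" and X: "lin X" and comm: "\<And>x. X (A x) = A (X x)"
  shows "X (diag_op f A v) = diag_op f A (X v)"
proof -
  have "X (diag_op f A v) = diag_op f A (X v)" if "v \<in> gen_eigenspace A c" for c v
    using gen_eigenspace_commute[OF A X comm that] that
    by (simp add: diag_op_gen_eigenspace[OF A] endo.linear_scale[OF X])
  from lin_eqI_gen_eigenspaces[OF A lin_compose[OF X lin_diag_op[OF A]]
      lin_compose[OF lin_diag_op[OF A] X] this]
  show ?thesis by (rule fun_cong)
qed

lemma diag_op_eq_self:
  assumes A: "lin A" and "span {v. \<exists>c. f c = c \<and> A v = c *s v} = UNIV"
  shows "diag_op f A = A"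
proof
  have "diag_op f A v = A v" if "f c = c" "A v = c *s v" for c v
    using diag_op_gen_eigenspace[OF A eigenvector_in_gen_eigenspace[OF A that(2)]] that by simp
  then show "diag_op f A v = A v" for v
    using endo.linear_eq_on[OF lin_diag_op[OF A] A, of v "{v. \<exists>c. f c = c \<and> A v = c *s v}"] assms(2)
    by blast
qed

lemma locally_nilpotent_if_scaled_shift:
  assumes A: "lin A" and N: "lin N"
    and shift: "\<And>c v. v \<in> gen_eigenspace A c \<Longrightarrow> N v = a c *s (A v - c *s v)"
  shows "locally_nilpotent N"
proof -
  have "v \<in> gen_kernel N" if "v \<in> gen_eigenspace A c" for c v
    using that
  proof (induction rule: gen_eigenspace_induct)
    case (step v)
    then have "N v \<in> gen_kernel N"
      by (simp only: shift subspace_scale[OF subspace_gen_kernel[OF N]])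
    then show ?case by (simp only: image_in_gen_kernel_iff[OF N])
  qed (rule zero_in_gen_kernel)
  then have "span (\<Union>c. gen_eigenspace A c) \<subseteq> gen_kernel N"
    by (intro span_minimal subspace_gen_kernel N) blast
  then show ?thesis unfolding span_gen_eigenspaces[OF A] locally_nilpotent_def by blast
qed

abbreviation semisimple_part :: "('a \<Rightarrow> 'a) \<Rightarrow> 'a \<Rightarrow> 'a" where
  "semisimple_part \<equiv> diag_op (\<lambda>c. c)"

lemma locally_nilpotent_minus_semisimple_part:
  assumes A: "lin A"
  shows "locally_nilpotent (\<lambda>x. A x - semisimple_part A x)"
proof (rule locally_nilpotent_if_scaled_shift[OF A])
  show "lin (\<lambda>x. A x - semisimple_part A x)" by (intro lin_intros lin_diag_op A)
  show "A v - semisimple_part A v = 1 *s (A v - c *s v)" if "v \<in> gen_eigenspace A c" for c v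
    using diag_op_gen_eigenspace[OF A that] by simp
qed

lemma trace_compose_diag_op:
  assumes A: "lin A"
  shows "trace (\<lambda>x. A (diag_op f A x)) = trace (diag_op (\<lambda>c. c * f c) A)"
proof -
  let ?N = "\<lambda>x. A (diag_op f A x) - diag_op (\<lambda>c. c * f c) A x"
  have N: "lin ?N" by (intro lin_intros lin_compose[OF A] lin_diag_op A)
  have "?N v = f c *s (A v - c *s v)" if "v \<in> gen_eigenspace A c" for c v
    using that by (simp add: diag_op_gen_eigenspace[OF A] endo.linear_scale[OF A]
        scale_right_diff_distrib mult.commute)
  then have "trace ?N = 0"
    by (rule trace_locally_nilpotent[OF N locally_nilpotent_if_scaled_shift[OF A N]])
  then show ?thesis by (simp add: trace_diff)
qed

subsection \<open>Diagonalizable operators\<close>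

definition diagonalizable :: "('a \<Rightarrow> 'a) \<Rightarrow> bool" where
  "diagonalizable A \<longleftrightarrow> span {v. \<exists>c. A v = c *s v} = UNIV"

lemma diagonalizable_gen_eigenspace:
  assumes A: "lin A" "diagonalizable A" and v: "v \<in> gen_eigenspace A c"
  shows "A v = c *s v"
  using diag_op_gen_eigenspace[OF A(1) v, of "\<lambda>c. c"] diag_op_eq_self[OF A(1), of "\<lambda>c. c"] A(2)
  unfolding diagonalizable_def by simp

lemma diagonalizable_diag_op:
  assumes A: "lin A"
  shows "diagonalizable (diag_op f A)"
proof -
  have "(\<Union>c. gen_eigenspace A c) \<subseteq> {v. \<exists>c. diag_op f A v = c *s v}"
    using diag_op_gen_eigenspace[OF A] by blast
  from span_mono[OF this] show ?thesis
    unfolding diagonalizable_def span_gen_eigenspaces[OF A] by blast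
qed

lemma diagonalizable_locally_nilpotent:
  assumes "lin A" "diagonalizable A" "locally_nilpotent A"
  shows "A v = 0"
  using diagonalizable_gen_eigenspace[OF assms(1,2), of v 0] assms(3)
  by (simp add: locally_nilpotent_def)

lemma diagonalizable_scale:
  assumes "diagonalizable A"
  shows "diagonalizable (\<lambda>x. c *s A x)"
proof -
  have "{v. \<exists>d. A v = d *s v} \<subseteq> {v. \<exists>d. c *s A v = d *s v}"
    by auto
  from span_mono[OF this] show ?thesis using assms unfolding diagonalizable_def by blast
qed

lemma simultaneously_diagonalizable:
  assumes "finite F" "\<And>X. X \<in> F \<Longrightarrow> lin X" "\<And>X. X \<in> F \<Longrightarrow> diagonalizable X"
    and "\<And>X Y v. X \<in> F \<Longrightarrow> Y \<in> F \<Longrightarrow> X (Y v) = Y (X v)"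
  shows "span {v. \<forall>X\<in>F. \<exists>c. X v = c *s v} = UNIV"
  using assms
proof (induction F rule: finite_induct)
  case (insert X F)
  let ?joint = "{v. \<forall>Y\<in>F. \<exists>c. Y v = c *s v}"
    and ?joint' = "{v. \<forall>Y\<in>insert X F. \<exists>c. Y v = c *s v}"
  have X: "lin X" "diagonalizable X" using insert.prems(1,2) by blast+
  have "v \<in> span ?joint'" if v: "v \<in> ?joint" for v
  proof -
    have "\<forall>Y\<in>F. \<exists>c. Y v = c *s v" using v by blast
    from bchoice[OF this] obtain c where c: "\<forall>Y\<in>F. Y v = c Y *s v" by blast
    define W where "W = {w. \<forall>Y\<in>F. Y w = c Y *s w}"
    have lin_F: "lin Y" if "Y \<in> F" for Y using insert.prems(1) that by simp
    have W: "subspace W"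
      unfolding W_def
      by (auto intro!: subspaceI simp: lin_F endo.linear_0 endo.linear_add endo.linear_scale
          scale_right_distrib mult.commute)
    have "Y (X w) = c Y *s X w" if "w \<in> W" "Y \<in> F" for w Y
    proof -
      have "Y (X w) = X (Y w)" using insert.prems(3) that(2) by blast
      also have "Y w = c Y *s w" using that unfolding W_def by blast
      finally show ?thesis by (simp only: endo.linear_scale[OF X(1)])
    qed
    then have XW: "X w \<in> W" if "w \<in> W" for w using that unfolding W_def by blast
    have "gen_eigenspace X d \<inter> W \<subseteq> ?joint'" for d
      using diagonalizable_gen_eigenspace[OF X, of _ d] unfolding W_def by auto
    then have "span (\<Union>d. gen_eigenspace X d \<inter> W) \<subseteq> span ?joint'" by (intro span_mono) blast
    moreover have "v \<in> W" using c by (simp add: W_def)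
    ultimately show ?thesis using invariant_subspace_gen_eigenspaces[OF X(1) W XW] by blast
  qed
  then have "span ?joint \<subseteq> span ?joint'" by (intro span_minimal) auto
  moreover have "span ?joint = UNIV" by (rule insert.IH) (use insert.prems in blast)+
  ultimately show ?case by blast
qed simp

lemma diagonalizable_add:
  assumes "lin A" "lin C" "diagonalizable A" "diagonalizable C" "\<And>v. A (C v) = C (A v)"
  shows "diagonalizable (\<lambda>x. A x + C x)"
proof -
  have "span {v. \<forall>X\<in>{A, C}. \<exists>c. X v = c *s v} = UNIV"
    by (rule simultaneously_diagonalizable) (use assms in auto)
  moreover have "{v. \<forall>X\<in>{A, C}. \<exists>c. X v = c *s v} \<subseteq> {v. \<exists>c. A v + C v = c *s v}"
    by (auto intro: exI[of _ "_ + _"] simp: scale_left_distrib)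
  ultimately show ?thesis unfolding diagonalizable_def using span_mono by blast
qed

end

locale complex_fd_operators = alg_closed_fd_operators scale Basis
  for scale :: "complex \<Rightarrow> 'a::ab_group_add \<Rightarrow> 'a" (infixr \<open>*s\<close> 75) and Basis :: "'a set"
begin

text \<open>Conjugation is used instead of a polynomial in \<open>A\<close> because it is additive, so that
  \<open>diag_op cnj A\<close> is a derivation whenever \<open>A\<close> is one.\<close>

lemma trace_compose_diag_op_cnj:
  assumes A: "lin A"
  obtains q :: real where "q \<ge> 0" "trace (\<lambda>x. A (diag_op cnj A x)) = of_real q"
    "q = 0 \<Longrightarrow> locally_nilpotent A"
proof -
  obtain B e where B: "independent B" "span B = UNIV" "finite B"
    and e: "\<And>b. b \<in> B \<Longrightarrow> b \<in> gen_eigenspace A (e b)"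
    using gen_eigenbasis[OF A] by metis
  let ?q = "\<Sum>b\<in>B. (cmod (e b))\<^sup>2"
  have "trace (\<lambda>x. A (diag_op cnj A x)) = (\<Sum>b\<in>B. e b * cnj (e b))"
    unfolding trace_compose_diag_op[OF A]
    by (rule trace_eigenbasis[OF B(1,2) lin_diag_op[OF A] diag_op_gen_eigenspace[OF A e]])
  also have "\<dots> = of_real ?q" by (simp only: of_real_sum complex_norm_square)
  finally have "trace (\<lambda>x. A (diag_op cnj A x)) = of_real ?q" .
  moreover have "locally_nilpotent A" if "?q = 0"
  proof -
    have "\<forall>b\<in>B. e b = 0" using that B(3) by (simp add: sum_nonneg_eq_0_iff)
    then have "B \<subseteq> gen_kernel A" using e by (metis gen_eigenspace_zero subsetI)
    from span_minimal[OF this subspace_gen_kernel[OF A]] show ?thesis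
      using B(2) by (auto simp: locally_nilpotent_def)
  qed
  moreover have "?q \<ge> 0" by (simp add: sum_nonneg)
  ultimately show ?thesis using that by blast
qed

lemma locally_nilpotent_if_trace_cnj_zero:
  assumes "lin A" "trace (\<lambda>x. A (diag_op cnj A x)) = 0"
  shows "locally_nilpotent A"
  using trace_compose_diag_op_cnj[OF assms(1)] assms(2) by (metis of_real_eq_0_iff)

end

section \<open>Lie algebras and the Killing form\<close>

locale fd_lie_algebra = complex_fd_operators sg Bg
  for sg :: "complex \<Rightarrow> 'g::ab_group_add \<Rightarrow> 'g" (infixr \<open>*s\<close> 75) and Bg :: "'g set" +
  fixes br :: "'g \<Rightarrow> 'g \<Rightarrow> 'g"
  assumes lie_algebra: "lie_algebra sg br"
begin

lemma lin_ad: "lin (br x)" and lin_br_left: "lin (\<lambda>x. br x y)"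
  using lie_algebra unfolding lie_algebra_def by blast+

lemmas br_zero_right [simp] = endo.linear_0[OF lin_ad]
  and br_add_right = endo.linear_add[OF lin_ad]
  and br_scale_right = endo.linear_scale[OF lin_ad]
  and br_diff_right = endo.linear_diff[OF lin_ad]
  and br_minus_right = endo.linear_neg[OF lin_ad]
  and br_zero_left [simp] = endo.linear_0[OF lin_br_left]
  and br_add_left = endo.linear_add[OF lin_br_left]
  and br_scale_left = endo.linear_scale[OF lin_br_left]
  and br_diff_left = endo.linear_diff[OF lin_br_left]
  and br_minus_left = endo.linear_neg[OF lin_br_left]

lemma br_self [simp]: "br x x = 0"
  using lie_algebra unfolding lie_algebra_def by blast

lemma br_anticomm: "br x y = - br y x"
proof -
  have "br x y + br y x = br (x + y) (x + y)"
    by (simp add: br_add_left br_add_right del: br_self) simp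
  then show ?thesis by (simp add: eq_neg_iff_add_eq_0)
qed

lemma jacobi: "br x (br y z) = br (br x y) z + br y (br x z)"
proof -
  have "br x (br y z) + br y (br z x) + br z (br x y) = 0"
    using lie_algebra unfolding lie_algebra_def by blast
  moreover have "br y (br z x) = - br y (br x z)"
    by (subst br_anticomm[of z x]) (simp add: br_minus_right)
  moreover have "br z (br x y) = - br (br x y) z" by (rule br_anticomm)
  ultimately show ?thesis by (simp add: algebra_simps)
qed

lemma ad_br: "br (br x y) z = br x (br y z) - br y (br x z)"
  by (simp add: jacobi[of x y z])

lemma ad_commute: "br x y = 0 \<Longrightarrow> br x (br y z) = br y (br x z)"
  by (simp add: jacobi[of x y z])

definition killing :: "'g \<Rightarrow> 'g \<Rightarrow> complex" where
  "killing x y = trace (\<lambda>z. br x (br y z))"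

lemma killing_commute: "killing x y = killing y x"
  unfolding killing_def by (rule trace_commute[OF lin_ad lin_ad])

lemma killing_add_left: "killing (x + y) z = killing x z + killing y z"
  unfolding killing_def br_add_left by (rule trace_add)

lemma killing_scale_left: "killing (c *s x) z = c * killing x z"
  unfolding killing_def br_scale_left by (rule trace_scale)

lemma killing_diff_left: "killing (x - y) z = killing x z - killing y z"
  unfolding killing_def br_diff_left by (rule trace_diff)

lemma killing_add_right: "killing x (y + z) = killing x y + killing x z"
  by (simp add: killing_commute[of x] killing_add_left)

lemma killing_scale_right: "killing x (c *s z) = c * killing x z"
  by (simp add: killing_commute[of x] killing_scale_left)

lemma killing_diff_right: "killing x (y - z) = killing x y - killing x z"
  by (simp add: killing_commute[of x] killing_diff_left)

lemma killing_zero_left [simp]: "killing 0 x = 0"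
  by (simp add: killing_def)

lemma linear_killing: "Vector_Spaces.linear sg (*) (killing x)"
  unfolding Vector_Spaces.linear_iff using vector_space_axioms
  by (auto simp: killing_add_right killing_scale_right vector_space_def algebra_simps)

lemma killing_invariant: "killing (br x y) z = killing x (br y z)"
  unfolding killing_def ad_br by (rule trace_commutator_cyclic[OF lin_ad lin_ad lin_ad])

lemma killing_zero_on_span:
  assumes "span S = UNIV" "\<And>y. y \<in> S \<Longrightarrow> killing x y = 0"
  shows "killing x y = 0"
proof -
  interpret Vector_Spaces.linear sg "(*)" "killing x" by (rule linear_killing)
  show ?thesis using eq_0_on_span[of S y] assms by simp
qed

lemma killing_zero_if_nilpotent_commuting:
  assumes "locally_nilpotent (br x)" "br x y = 0"
  shows "killing x y = 0"
proof -
  have "locally_nilpotent (\<lambda>z. br y (br x z))"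
    by (rule locally_nilpotent_compose_commuting[OF lin_ad assms(1) lin_ad])
       (rule ad_commute[OF assms(2), symmetric])
  then have "killing y x = 0"
    unfolding killing_def by (rule trace_locally_nilpotent[OF lin_compose[OF lin_ad lin_ad]])
  then show ?thesis by (simp add: killing_commute)
qed

definition derivation :: "('g \<Rightarrow> 'g) \<Rightarrow> bool" where
  "derivation D \<longleftrightarrow> lin D \<and> (\<forall>x y. D (br x y) = br (D x) y + br x (D y))"

lemma gen_eigenspace_br:
  assumes "u \<in> gen_eigenspace (br x) a" "v \<in> gen_eigenspace (br x) b"
  shows "br u v \<in> gen_eigenspace (br x) (a + b)"
  using assms
proof (induction arbitrary: v rule: gen_eigenspace_induct)
  case zero
  then show ?case by (simp add: zero_in_gen_eigenspace)
next
  case (step u)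
  note outer_IH = step.IH
  from step.prems show ?case
  proof (induction rule: gen_eigenspace_induct)
    case zero
    then show ?case by (simp add: zero_in_gen_eigenspace)
  next
    case (step v)
    have "br (br x u - a *s u) v + br u (br x v - b *s v) \<in> gen_eigenspace (br x) (a + b)"
      using outer_IH[OF step.hyps] step.IH
      by (rule subspace_add[OF subspace_gen_eigenspace[OF lin_ad]])
    also have "br (br x u - a *s u) v + br u (br x v - b *s v) = br x (br u v) - (a + b) *s br u v"
      by (simp add: jacobi[of x u v] br_diff_left br_diff_right br_scale_left br_scale_right
          scale_left_distrib)
    finally show ?case by (simp only: shift_in_gen_eigenspace_iff[OF lin_ad])
  qed
qed

lemma derivation_diag_op:
  assumes additive: "\<And>a b. f (a + b) = f a + f b"
  shows "derivation (diag_op f (br x))"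
proof -
  let ?D = "diag_op f (br x)" and ?G = "\<Union>c. gen_eigenspace (br x) c"
  note D = lin_diag_op[OF lin_ad, of f x]
  let ?\<delta> = "\<lambda>u v. ?D (br u v) - br (?D u) v - br u (?D v)"
  have "?\<delta> u v \<in> {0}" for u v
  proof (rule bilinear_span_into_subspace[where f = ?\<delta> and A = ?G and B = ?G])
    show "lin (\<lambda>v. ?\<delta> u v)" for u
      by (intro lin_intros lin_compose[OF D] lin_compose[OF lin_ad] lin_ad D)
    show "lin (\<lambda>u. ?\<delta> u v)" for v
      by (intro lin_intros lin_compose[OF D lin_br_left] lin_compose[OF lin_br_left D] lin_br_left)
    show "?\<delta> u v \<in> {0}" if uv: "u \<in> ?G" "v \<in> ?G" for u v
    proof -
      obtain a b where u: "u \<in> gen_eigenspace (br x) a" and v: "v \<in> gen_eigenspace (br x) b"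
        using uv by blast
      show ?thesis
        by (simp add: diag_op_gen_eigenspace[OF lin_ad u] diag_op_gen_eigenspace[OF lin_ad v]
            diag_op_gen_eigenspace[OF lin_ad gen_eigenspace_br[OF u v]] additive scale_left_distrib
            br_scale_left br_scale_right)
    qed
  qed (simp_all add: span_gen_eigenspaces[OF lin_ad])
  then show ?thesis unfolding derivation_def using D by (simp add: algebra_simps)
qed

subsection \<open>Engel's theorem\<close>

definition lie_subalgebra :: "'g set \<Rightarrow> bool" where
  "lie_subalgebra M \<longleftrightarrow> subspace M \<and> (\<forall>x\<in>M. \<forall>y\<in>M. br x y \<in> M)"

lemma lie_subalgebra_insert:
  assumes N: "lie_subalgebra N" and x: "\<And>n. n \<in> N \<Longrightarrow> br n x \<in> N"
  shows "lie_subalgebra (span (insert x N))"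
proof -
  have "subspace N" and N_br: "\<And>m n. m \<in> N \<Longrightarrow> n \<in> N \<Longrightarrow> br m n \<in> N"
    using N unfolding lie_subalgebra_def by blast+
  then have "br x n \<in> N" if "n \<in> N" for n
    using x[OF that] subspace_neg br_anticomm[of x n] by metis
  then have "br u v \<in> N" if "u \<in> insert x N" "v \<in> insert x N" for u v
    using that x N_br subspace_0[OF \<open>subspace N\<close>] by (elim insertE) auto
  then have "br u v \<in> span (insert x N)" if "u \<in> insert x N" "v \<in> insert x N" for u v
    using that by (intro span_base) blast
  then have "br u v \<in> span (insert x N)" if "u \<in> span (insert x N)" "v \<in> span (insert x N)" for u v
    using that by (rule bilinear_span_into_subspace[OF lin_ad lin_br_left subspace_span])
  then show ?thesis unfolding lie_subalgebra_def by simp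
qed

lemma maximal_proper_lie_subalgebra:
  assumes "lie_subalgebra M" "M \<noteq> {0}"
  obtains N where "lie_subalgebra N" "N \<subset> M"
    "\<And>N'. lie_subalgebra N' \<Longrightarrow> N \<subset> N' \<Longrightarrow> N' \<subseteq> M \<Longrightarrow> N' = M"
proof -
  define Q where "Q N \<longleftrightarrow> lie_subalgebra N \<and> N \<subset> M" for N
  have "Q {0}"
    using assms subspace_0 unfolding Q_def lie_subalgebra_def by auto
  moreover have "\<forall>N. Q N \<longrightarrow> dim N < Suc (dim M)"
    unfolding Q_def by (auto simp: less_Suc_eq_le intro!: dim_subset)
  ultimately obtain N where N: "Q N" and max: "\<And>N'. Q N' \<Longrightarrow> dim N' \<le> dim N"
    using ex_has_greatest_nat[of Q "{0}" dim] by blast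
  have "N' = M" if N': "lie_subalgebra N'" "N \<subset> N'" "N' \<subseteq> M" for N'
  proof (rule ccontr)
    assume "N' \<noteq> M"
    then have "dim N' \<le> dim N" using N' by (intro max) (auto simp: Q_def)
    moreover have "dim N < dim N'"
      using N N'(1,2) by (intro subspace_dim_psubset) (simp_all add: Q_def lie_subalgebra_def)
    ultimately show False by simp
  qed
  then show ?thesis using that N unfolding Q_def by blast
qed

lemma engel_extend:
  assumes "subspace N" and x: "locally_nilpotent (br x)" "\<And>n. n \<in> N \<Longrightarrow> br n x \<in> N"
    and W: "subspace W'" "\<And>w. w \<in> W \<Longrightarrow> br x w \<in> W" "\<And>w. w \<in> W' \<Longrightarrow> br x w \<in> W'"
    and w: "w \<in> W - W'" "\<And>n. n \<in> N \<Longrightarrow> br n w \<in> W'"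
  shows "\<exists>w\<in>W - W'. \<forall>m\<in>span (insert x N). br m w \<in> W'"
proof -
  obtain k where k: "(br x ^^ k) w \<notin> W'" "br x ((br x ^^ k) w) \<in> W'"
    using gen_kernel_last_outside[of w "br x" W'] x(1) w(1) subspace_0[OF W(1)]
    unfolding locally_nilpotent_def by blast
  have pow: "(br x ^^ i) w \<in> W \<and> (\<forall>n\<in>N. br n ((br x ^^ i) w) \<in> W')" for i
  proof (induction i)
    case (Suc i)
    have "br n (br x ((br x ^^ i) w)) \<in> W'" if "n \<in> N" for n
      unfolding jacobi[of n x] using Suc x(2)[OF that] W(3) that
      by (intro subspace_add[OF W(1)]) auto
    then show ?case using Suc W(2) by simp
  qed (use w in simp)
  have "br m ((br x ^^ k) w) \<in> W'" if "m \<in> span (insert x N)" for m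
    by (rule linear_span_into_subspace[OF lin_br_left W(1) _ that]) (use pow k(2) in auto)
  then show ?thesis using pow k(1) by blast
qed

text \<open>Stated for the action on \<open>W / W'\<close> so that the induction, where \<open>N\<close> acts on \<open>M / N\<close>, needs
  no quotients.\<close>

lemma engel:
  assumes "lie_subalgebra M" "\<And>x. x \<in> M \<Longrightarrow> locally_nilpotent (br x)"
    and "subspace W'" "W' \<subset> W"
    and "\<And>x w. x \<in> M \<Longrightarrow> w \<in> W \<Longrightarrow> br x w \<in> W" "\<And>x w. x \<in> M \<Longrightarrow> w \<in> W' \<Longrightarrow> br x w \<in> W'"
  shows "\<exists>w\<in>W - W'. \<forall>x\<in>M. br x w \<in> W'"
  using assms
proof (induction "dim M" arbitrary: M W W' rule: less_induct)
  case less
  show ?case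
  proof (cases "M = {0}")
    case True
    then show ?thesis using less.prems(3,4) subspace_0 by auto
  next
    case False
    then obtain N where N: "lie_subalgebra N" "N \<subset> M"
      and maximal: "\<And>N'. lie_subalgebra N' \<Longrightarrow> N \<subset> N' \<Longrightarrow> N' \<subseteq> M \<Longrightarrow> N' = M"
      using maximal_proper_lie_subalgebra[OF less.prems(1)] by metis
    have subspaces: "subspace N" "subspace M"
      using N(1) less.prems(1) unfolding lie_subalgebra_def by auto
    then have "dim N < dim M" by (rule subspace_dim_psubset) (rule N(2))
    note IH = less.hyps[OF this N(1)]
    have "\<exists>x\<in>M - N. \<forall>n\<in>N. br n x \<in> N"
      using N less.prems(1,2) unfolding lie_subalgebra_def by (intro IH) auto
    then obtain x where x: "x \<in> M" "x \<notin> N" "\<And>n. n \<in> N \<Longrightarrow> br n x \<in> N" by blast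
    have "\<exists>w\<in>W - W'. \<forall>n\<in>N. br n w \<in> W'"
      using N(2) less.prems by (intro IH) auto
    then have "\<exists>w\<in>W - W'. \<forall>m\<in>span (insert x N). br m w \<in> W'"
      using engel_extend[OF subspaces(1) less.prems(2)[OF x(1)] x(3) less.prems(3)]
        less.prems(5,6)[OF x(1)] by blast
    moreover have "span (insert x N) = M"
    proof (rule maximal[OF lie_subalgebra_insert[OF N(1) x(3)]])
      show "N \<subset> span (insert x N)" using x(2) span_superset[of "insert x N"] by blast
      show "span (insert x N) \<subseteq> M" using x(1) N(2) by (intro span_minimal subspaces(2)) auto
    qed
    ultimately show ?thesis by simp
  qed
qed

end

subsection \<open>Nondegeneracy of the Killing form and its consequences\<close>

locale simple_fd_lie_algebra = fd_lie_algebra +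
  assumes simple: "simple_lie_algebra sg br"
begin

lemma ideal_cases: "lie_ideal sg br I \<Longrightarrow> I = {0} \<or> I = UNIV"
  and nonabelian: "\<exists>x y. br x y \<noteq> 0"
  using simple unfolding simple_lie_algebra_def by blast+

lemma center_zero:
  assumes "\<And>y. br x y = 0"
  shows "x = 0"
proof -
  have "lie_ideal sg br {x. \<forall>y. br x y = 0}"
    unfolding lie_ideal_def by (auto simp: subspace_def br_add_left br_scale_left ad_br)
  from ideal_cases[OF this] show ?thesis using nonabelian assms by blast
qed

lemma span_brackets: "span {br x y |x y. True} = UNIV"
proof -
  have "lie_ideal sg br (span {br x y |x y. True})"
    unfolding lie_ideal_def by (auto intro: span_base)
  moreover obtain x y where "br x y \<noteq> 0" using nonabelian by blast
  moreover have "br x y \<in> span {br x y |x y. True}" by (intro span_base) blast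
  ultimately show ?thesis using ideal_cases by blast
qed

lemma not_all_ad_nilpotent: "\<exists>x. \<not> locally_nilpotent (br x)"
proof (rule ccontr)
  assume "\<not> ?thesis"
  moreover have "{0} \<subset> (UNIV :: 'a set)" using nonabelian by blast
  ultimately have "\<exists>w\<in>UNIV - {0}. \<forall>x\<in>UNIV. br x w \<in> {0}"
    by (intro engel) (simp_all add: lie_subalgebra_def)
  then obtain w where w: "w \<noteq> 0" "\<And>x. br x w = 0" by blast
  then have "br w y = 0" for y using br_anticomm[of w y] by simp
  then show False using center_zero w(1) by blast
qed

lemma killing_nonzero: "\<exists>x y. killing x y \<noteq> 0"
proof (rule ccontr)
  assume "\<not> ?thesis"
  then have killing_zero: "killing x y = 0" for x y by blast
  have "locally_nilpotent (br x)" for x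
  proof -
    let ?D = "diag_op cnj (br x)"
    have D: "lin ?D" and D_br: "\<And>a b. ?D (br a b) = br (?D a) b + br a (?D b)"
      using derivation_diag_op[of cnj x] unfolding derivation_def by simp_all
    have "trace (\<lambda>v. br (br a b) (?D v)) = - killing a (?D b)" for a b
    proof -
      have "trace (\<lambda>v. br (br a b) (?D v)) = trace (\<lambda>v. br a (br b (?D v) - ?D (br b v)))"
        unfolding ad_br by (rule trace_commutator_cyclic[OF lin_ad lin_ad D])
      also have "\<dots> = trace (\<lambda>v. (- 1) *s br a (br (?D b) v))"
        by (simp add: D_br br_minus_right)
      also have "\<dots> = - killing a (?D b)" unfolding trace_scale killing_def by simp
      finally show ?thesis .
    qed
    moreover have "subspace {z. trace (\<lambda>v. br z (?D v)) = 0}"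
      by (simp add: subspace_def br_add_left br_scale_left trace_add trace_scale)
    ultimately have "span {br x y |x y. True} \<subseteq> {z. trace (\<lambda>v. br z (?D v)) = 0}"
      using killing_zero by (intro span_minimal) auto
    then have "trace (\<lambda>v. br x (?D v)) = 0" unfolding span_brackets by blast
    then show ?thesis by (rule locally_nilpotent_if_trace_cnj_zero[OF lin_ad])
  qed
  then show False using not_all_ad_nilpotent by blast
qed

lemma killing_nondegenerate:
  assumes "\<And>y. killing x y = 0"
  shows "x = 0"
proof -
  have "killing (br z x) y = 0" if "\<forall>y. killing x y = 0" for x y z
    using that killing_invariant[of z x y] killing_invariant[of x y z] killing_commute by metis
  then have "lie_ideal sg br {x. \<forall>y. killing x y = 0}"
    unfolding lie_ideal_def by (simp add: subspace_def killing_add_left killing_scale_left)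
  from ideal_cases[OF this] show ?thesis using killing_nonzero assms by blast
qed

text \<open>With \<open>x\<close> chosen so that \<open>ad x\<close> and \<open>D\<close> have the same trace against every \<open>ad y\<close>, the
  difference \<open>E = D - ad x\<close> is a derivation with
  \<open>\<kappa>(E a, b) = tr ([E, ad a] ad b) = tr (E ad [a, b]) = 0\<close>.\<close>

lemma derivation_inner:
  assumes D: "derivation D"
  obtains x where "D = br x"
proof -
  have lin_D: "lin D" and D_br: "\<And>a b. D (br a b) = br (D a) b + br a (D b)"
    using D unfolding derivation_def by blast+
  have "Vector_Spaces.linear sg (*) (\<lambda>y. trace (\<lambda>z. D (br y z)))"
    unfolding Vector_Spaces.linear_iff using linear_killing[of 0]
    by (simp add: Vector_Spaces.linear_iff br_add_left br_scale_left endo.linear_add[OF lin_D]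
        endo.linear_scale[OF lin_D] trace_add trace_scale)
  then obtain x where x: "\<And>y. killing x y = trace (\<lambda>z. D (br y z))"
    using nondegenerate_form_represents[of killing, OF killing_add_left killing_scale_left
        linear_killing killing_nondegenerate] by blast
  define E where "E y = D y - br x y" for y
  have lin_E: "lin E" unfolding E_def by (intro lin_intros lin_D lin_ad)
  have E_br: "E (br a b) = br (E a) b + br a (E b)" for a b
    unfolding E_def by (simp add: D_br jacobi[of x a b] br_diff_left br_diff_right)
  have "E a = 0" for a
  proof (rule killing_nondegenerate)
    fix b
    have "killing (E a) b = trace (\<lambda>z. E (br a (br b z)) - br a (E (br b z)))"
      unfolding killing_def by (simp add: E_br)
    also have "\<dots> = trace (\<lambda>z. E (br (br a b) z))"
      unfolding ad_br by (rule trace_commutator_cyclic[OF lin_E lin_ad lin_ad])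
    also have "\<dots> = 0" unfolding E_def trace_diff killing_def[symmetric] x by simp
    finally show "killing (E a) b = 0" .
  qed
  then have "D = br x" unfolding E_def by auto
  then show ?thesis by (rule that)
qed

lemma jordan_decomposition:
  "\<exists>s. diagonalizable (br s) \<and> locally_nilpotent (br (x - s)) \<and> (\<forall>y. br x y = 0 \<longrightarrow> br s y = 0)"
proof -
  have "derivation (semisimple_part (br x))" by (rule derivation_diag_op) simp
  then obtain s where s: "semisimple_part (br x) = br s" by (rule derivation_inner)
  have "diagonalizable (br s)" using diagonalizable_diag_op[OF lin_ad] s by metis
  moreover have "locally_nilpotent (br (x - s))"
    using locally_nilpotent_minus_semisimple_part[OF lin_ad, of x]
    unfolding s br_diff_left[symmetric] .
  moreover have "br s y = 0" if "br x y = 0" for y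
  proof -
    have "y \<in> gen_eigenspace (br x) 0"
      using that by (intro eigenvector_in_gen_eigenspace lin_ad) simp
    from diag_op_gen_eigenspace[OF lin_ad this] show ?thesis unfolding s[symmetric] by simp
  qed
  ultimately show ?thesis by blast
qed

end

section \<open>Representations of \<open>sl\<^sub>2\<close>\<close>

locale sl2_rep = fd_linear_operators scale Basis
  for scale :: "'f::field_char_0 \<Rightarrow> 'a::ab_group_add \<Rightarrow> 'a" (infixr \<open>*s\<close> 75) and Basis :: "'a set" +
  fixes E F H :: "'a \<Rightarrow> 'a"
  assumes lin_E: "lin E" and lin_F: "lin F" and lin_H: "lin H"
    and HE: "\<And>v. H (E v) = E (H v) + 2 *s E v"
    and HF: "\<And>v. H (F v) = F (H v) - 2 *s F v"
    and EF: "\<And>v. E (F v) = F (E v) + H v"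
begin

lemma swap_sl2_rep: "sl2_rep scale Basis F E (\<lambda>v. - H v)"
proof (intro sl2_rep.intro sl2_rep_axioms.intro fd_linear_operators_axioms)
  show "lin F" "lin E" "lin (\<lambda>v. - H v)" by (intro lin_F lin_E endo.linear_compose_neg lin_H)+
  show "- H (F v) = F (- H v) + 2 *s F v" for v by (simp add: HF endo.linear_neg[OF lin_F])
  show "- H (E v) = E (- H v) - 2 *s E v" for v by (simp add: HE endo.linear_neg[OF lin_E])
  show "F (E v) = E (F v) + - H v" for v by (simp add: EF)
qed

lemma weight_E_pow:
  assumes "H v = m *s v"
  shows "H ((E ^^ k) v) = (m + 2 * of_nat k) *s (E ^^ k) v"
proof (induction k)
  case (Suc k)
  have "H ((E ^^ Suc k) v) = E (H ((E ^^ k) v)) + 2 *s (E ^^ Suc k) v" by (simp add: HE)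
  also have "\<dots> = (m + 2 * of_nat k) *s (E ^^ Suc k) v + 2 *s (E ^^ Suc k) v"
    unfolding Suc endo.linear_scale[OF lin_E] by simp
  also have "\<dots> = ((m + 2 * of_nat k) + 2) *s (E ^^ Suc k) v" by (simp only: scale_left_distrib)
  also have "(m + 2 * of_nat k) + 2 = m + 2 * of_nat (Suc k)" by simp
  finally show ?case .
qed (simp add: assms)

lemma weight_in_gen_kernel_E:
  assumes "H v = m *s v"
  shows "v \<in> gen_kernel E"
proof -
  obtain r i where ri: "i \<le> dim (UNIV :: 'a set)" "r i \<noteq> 0"
      "(\<Sum>k\<le>dim (UNIV :: 'a set). r k *s (E ^^ k) v) = 0"
    by (rule nontrivial_relation[OF order_refl])
  have "r i *s (E ^^ i) v = 0"
  proof (rule gen_eigenspace_independent[OF lin_H finite_atMost _ _ ri(3)])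
    show "inj_on (\<lambda>k. m + 2 * of_nat k) {..dim (UNIV :: 'a set)}" by (simp add: inj_on_def)
    show "r k *s (E ^^ k) v \<in> gen_eigenspace H (m + 2 * of_nat k)" for k
      using weight_E_pow[OF assms, of k]
      by (intro subspace_scale[OF subspace_gen_eigenspace] eigenvector_in_gen_eigenspace lin_H)
  qed (use ri(1) in simp)
  then have "(E ^^ i) v = 0" using ri(2) by simp
  then show ?thesis unfolding gen_kernel_def by blast
qed

lemma F_E_pow:
  assumes "H v = m *s v"
  shows "F ((E ^^ Suc k) v) = (E ^^ Suc k) (F v) - (of_nat (Suc k) * (m + of_nat k)) *s (E ^^ k) v"
proof (induction k)
  case 0
  then show ?case using EF[of v] by (simp add: assms)
next
  case (Suc k)
  let ?w = "(E ^^ Suc k) v" and ?c = "of_nat (Suc k) * (m + of_nat k)"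
  have "F (E ?w) = E (F ?w) - H ?w" by (simp add: EF)
  also have "E (F ?w) = (E ^^ Suc (Suc k)) (F v) - ?c *s ?w"
    unfolding Suc by (simp add: endo.linear_diff[OF lin_E] endo.linear_scale[OF lin_E])
  also have "H ?w = (m + 2 * of_nat (Suc k)) *s ?w" by (rule weight_E_pow[OF assms])
  also have "(E ^^ Suc (Suc k)) (F v) - ?c *s ?w - (m + 2 * of_nat (Suc k)) *s ?w
      = (E ^^ Suc (Suc k)) (F v) - (?c + (m + 2 * of_nat (Suc k))) *s ?w"
    unfolding scale_left_distrib by (simp only: diff_diff_eq)
  also have "?c + (m + 2 * of_nat (Suc k)) = of_nat (Suc (Suc k)) * (m + of_nat (Suc k))"
    by (simp add: algebra_simps)
  finally show ?case by simp
qed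

interpretation swap: sl2_rep scale Basis F E "\<lambda>v. - H v"
  by (rule swap_sl2_rep)

lemma weight_F_pow: "H v = m *s v \<Longrightarrow> H ((F ^^ k) v) = (m - 2 * of_nat k) *s (F ^^ k) v"
  using swap.weight_E_pow[of v "- m" k]
  by (simp add: scale_left_diff_distrib scale_left_distrib minus_equation_iff[of "H ((F ^^ k) v)"])

lemma weight_in_gen_kernel_F: "H v = m *s v \<Longrightarrow> v \<in> gen_kernel F"
  by (rule swap.weight_in_gen_kernel_E[of v "- m"]) simp

lemma E_F_pow:
  assumes "E u = 0" "H u = m *s u"
  shows "E ((F ^^ Suc k) u) = (of_nat (Suc k) * (m - of_nat k)) *s (F ^^ k) u"
proof -
  have "E ((F ^^ Suc k) u) = - ((of_nat (Suc k) * (- m + of_nat k)) *s (F ^^ k) u)"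
    using swap.F_E_pow[of u "- m" k] assms endo.linear_0[OF lin_funpow[OF lin_F]]
    by (simp del: funpow.simps of_nat_Suc)
  also have "\<dots> = (of_nat (Suc k) * (m - of_nat k)) *s (F ^^ k) u"
    unfolding scale_minus_left[symmetric] by (simp add: algebra_simps)
  finally show ?thesis .
qed

lemma weight_integral:
  assumes "v \<noteq> 0" "H v = c *s v"
  shows "c \<in> \<int>"
proof -
  obtain k where k: "(E ^^ k) v \<noteq> 0" "E ((E ^^ k) v) = 0"
    using gen_kernel_last_outside[of v E "{0}"] weight_in_gen_kernel_E[OF assms(2)] assms(1) by auto
  define u where "u = (E ^^ k) v"
  have u: "u \<noteq> 0" "E u = 0" "H u = (c + 2 * of_nat k) *s u"
    using k weight_E_pow[OF assms(2)] unfolding u_def by simp_all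
  obtain j where j: "(F ^^ j) u \<noteq> 0" "(F ^^ Suc j) u = 0"
    using gen_kernel_last_outside[of u F "{0}"] weight_in_gen_kernel_F[OF u(3)] u(1) by auto
  have "(of_nat (Suc j) * (c + 2 * of_nat k - of_nat j)) *s (F ^^ j) u = 0"
    using E_F_pow[OF u(2,3), of j] unfolding j(2) by (simp add: endo.linear_0[OF lin_E])
  then have "c + 2 * of_nat k - of_nat j = 0" using j(1) by (simp del: of_nat_Suc)
  then have "c = of_nat j - 2 * of_nat k" by (simp add: algebra_simps)
  then show ?thesis by simp
qed

text \<open>A lowest weight vector of the quotient by \<open>U\<close> has weight \<open>0, -1, -2, \<dots>\<close>.\<close>

lemma lowering_injective_mod:
  assumes U: "subspace U" "\<And>v. v \<in> U \<Longrightarrow> E v \<in> U" "\<And>v. v \<in> U \<Longrightarrow> F v \<in> U"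
    and v: "F v \<in> U" "H v = m *s v" and m: "\<And>k. m + of_nat k \<noteq> 0"
  shows "v \<in> U"
proof (rule ccontr)
  assume "v \<notin> U"
  then obtain k where k: "(E ^^ k) v \<notin> U" "(E ^^ Suc k) v \<in> U"
    using gen_kernel_last_outside[OF weight_in_gen_kernel_E[OF v(2)] _ subspace_0[OF U(1)]] by auto
  let ?c = "of_nat (Suc k) * (m + of_nat k)"
  have "(E ^^ j) (F v) \<in> U" for j by (induction j) (simp_all add: U(2) v(1))
  then have "(E ^^ Suc k) (F v) - F ((E ^^ Suc k) v) \<in> U"
    by (intro subspace_diff[OF U(1)] U(3) k(2))
  then have "?c *s (E ^^ k) v \<in> U" unfolding F_E_pow[OF v(2)] by simp
  moreover have "?c \<noteq> 0" using m[of k] by (simp del: of_nat_Suc)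
  ultimately have "(E ^^ k) v \<in> U"
    using subspace_scale[OF U(1)] by (metis left_inverse scale_one scale_scale)
  with k(1) show False ..
qed

lemma E_pow_F_pow:
  assumes u: "E u = 0" "H u = m *s u" and m: "\<And>i. i < n \<Longrightarrow> m \<noteq> of_nat i"
  shows "\<exists>c. c \<noteq> 0 \<and> (E ^^ n) ((F ^^ n) u) = c *s u"
  using m
proof (induction n)
  case 0
  show ?case by (intro exI[of _ 1]) simp
next
  case (Suc n)
  then obtain c where c: "c \<noteq> 0" "(E ^^ n) ((F ^^ n) u) = c *s u" by auto
  let ?d = "of_nat (Suc n) * (m - of_nat n)"
  have "(E ^^ Suc n) ((F ^^ Suc n) u) = (E ^^ n) (E ((F ^^ Suc n) u))"
    by (simp only: funpow_Suc_right o_apply)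
  also have "\<dots> = (?d * c) *s u"
    unfolding E_F_pow[OF u] by (simp add: endo.linear_scale[OF lin_funpow[OF lin_E]] c(2))
  finally show ?case
    using c(1) Suc.prems[of n] by (intro exI[of _ "?d * c"]) (simp del: of_nat_Suc funpow.simps)
qed

lemma weight_in_span_lowered_highest:
  assumes "H v = of_nat m *s v"
  shows "v \<in> span {(F ^^ n) u |n u. E u = 0 \<and> H u = of_nat (m + 2 * n) *s u}" (is "_ \<in> span ?S")
proof -
  have "v \<in> span ?S" if "(E ^^ n) v = 0" "H v = of_nat m *s v" for n v
    using that
  proof (induction n arbitrary: v)
    case 0
    then show ?case by (simp add: span_zero)
  next
    case (Suc n)
    define u where "u = (E ^^ n) v"
    have u: "E u = 0" "H u = of_nat (m + 2 * n) *s u"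
      using Suc.prems(1) weight_E_pow[OF Suc.prems(2), of n] unfolding u_def by simp_all
    have "of_nat (m + 2 * n) \<noteq> (of_nat i :: 'f)" if "i < n" for i
      using that by (simp only: of_nat_eq_iff)
    then obtain c where c: "c \<noteq> 0" "(E ^^ n) ((F ^^ n) u) = c *s u"
      using E_pow_F_pow[OF u, of n] by blast
    define w where "w = (1 / c) *s (F ^^ n) u"
    have "(E ^^ n) (v - w) = 0"
      using c by (simp add: w_def endo.linear_diff[OF lin_funpow[OF lin_E]]
          endo.linear_scale[OF lin_funpow[OF lin_E]] u_def[symmetric])
    moreover have "H w = of_nat m *s w"
      by (simp add: w_def endo.linear_scale[OF lin_H] weight_F_pow[OF u(2)] mult.commute)
    then have "H (v - w) = of_nat m *s (v - w)"
      by (simp add: endo.linear_diff[OF lin_H] Suc.prems(2) scale_right_diff_distrib)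
    ultimately have "v - w \<in> span ?S" by (rule Suc.IH)
    moreover have "w \<in> span ?S"
      unfolding w_def using u by (intro span_scale span_base) blast
    ultimately show ?case using span_add[of "v - w" ?S w] by simp
  qed
  then show ?thesis
    using weight_in_gen_kernel_E[OF assms] assms unfolding gen_kernel_def by blast
qed

end

context fd_lie_algebra
begin

definition sl2_triple :: "'g \<Rightarrow> 'g \<Rightarrow> 'g \<Rightarrow> bool" where
  "sl2_triple e f h \<longleftrightarrow> br e f = h \<and> br h e = 2 *s e \<and> br h f = - (2 *s f)"

lemma sl2_triple_swap: "sl2_triple e f h \<Longrightarrow> sl2_triple f e (- h)"
  unfolding sl2_triple_def using br_anticomm[of f e] by (simp add: br_minus_left)

lemma adjoint_lie_module: "lie_module sg br sg br"
  unfolding lie_module_def using vector_space_axioms lin_ad lin_br_left ad_br by blast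

lemma sl2_rep_of_lie_module:
  assumes triple: "sl2_triple e f h" and W: "fd_linear_operators s B"
    and module: "lie_module sg br s r"
  shows "sl2_rep s B (r e) (r f) (r h)"
proof -
  interpret W: fd_linear_operators s B by (rule W)
  interpret GW: vector_space_pair sg s ..
  have lin_r: "W.lin (r x)" and lin_r_left: "Vector_Spaces.linear sg s (\<lambda>x. r x v)"
    and r_br: "r (br x y) v = r x (r y v) - r y (r x v)" for x y v
    using module unfolding lie_module_def by blast+
  note r_scale = GW.linear_scale[OF lin_r_left] and r_minus = GW.linear_neg[OF lin_r_left]
  show ?thesis
  proof (intro sl2_rep.intro sl2_rep_axioms.intro W lin_r)
    show "r h (r e v) = r e (r h v) + s 2 (r e v)" for v
      using triple r_br[of h e v] by (simp add: sl2_triple_def r_scale)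
    show "r h (r f v) = r f (r h v) - s 2 (r f v)" for v
      using triple r_br[of h f v] by (simp add: sl2_triple_def r_scale r_minus algebra_simps)
    show "r e (r f v) = r f (r e v) + r h v" for v
      using triple r_br[of e f v] by (simp add: sl2_triple_def)
  qed
qed

end

section \<open>Root space decomposition\<close>

context fd_lie_algebra
begin

lemma ad_semisimple_iff: "ad_semisimple sg br x \<longleftrightarrow> diagonalizable (br x)"
  unfolding ad_semisimple_def diagonalizable_def ..

lemma toral_insert:
  assumes T: "toral sg br T" and s: "diagonalizable (br s)" "\<And>t. t \<in> T \<Longrightarrow> br s t = 0"
  shows "toral sg br (span (insert s T))"
proof -
  have "subspace T" and T_br: "\<And>x y. x \<in> T \<Longrightarrow> y \<in> T \<Longrightarrow> br x y = 0"
    and T_diag: "\<And>x. x \<in> T \<Longrightarrow> diagonalizable (br x)"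
    using T unfolding toral_def ad_semisimple_iff by blast+
  have br_s: "br t s = 0" if "t \<in> T" for t using s(2)[OF that] br_anticomm[of t s] by simp
  have "br x y \<in> {0}" if "x \<in> span (insert s T)" "y \<in> span (insert s T)" for x y
    by (rule bilinear_span_into_subspace[OF lin_ad lin_br_left subspace_single_0 _ that])
       (use s(2) br_s T_br in auto)
  moreover have "diagonalizable (br x)" if x: "x \<in> span (insert s T)" for x
  proof -
    have "span T = T" using \<open>subspace T\<close> by simp
    then obtain c where c: "x - c *s s \<in> T" using x unfolding span_breakdown_eq by metis
    define t where "t = x - c *s s"
    have "diagonalizable (\<lambda>v. br t v + c *s br s v)"
    proof (rule diagonalizable_add)
      show "br t (c *s br s v) = c *s br s (br t v)" for v
        using ad_commute[OF br_s, of t v] c by (simp add: t_def br_scale_right)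
    qed (use c in \<open>auto simp: t_def intro!: T_diag diagonalizable_scale s(1) lin_ad lin_intros\<close>)
    also have "(\<lambda>v. br t v + c *s br s v) = br x"
      by (simp add: fun_eq_iff t_def br_diff_left br_scale_left)
    finally show ?thesis .
  qed
  ultimately show ?thesis unfolding toral_def ad_semisimple_iff by simp
qed

end

locale cartan_lie_algebra = simple_fd_lie_algebra +
  fixes H :: "'a set"
  assumes cartan: "cartan_subalgebra sg br H"
begin

lemma toral_H: "toral sg br H"
  and maximal_H: "toral sg br T \<Longrightarrow> H \<subseteq> T \<Longrightarrow> T = H"
  using cartan unfolding cartan_subalgebra_def by blast+

lemma subspace_H: "subspace H"
  and br_H_H: "x \<in> H \<Longrightarrow> y \<in> H \<Longrightarrow> br x y = 0"
  and diagonalizable_H: "h \<in> H \<Longrightarrow> diagonalizable (br h)"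
  using toral_H unfolding toral_def ad_semisimple_iff by blast+

lemma commuting_semisimple_in_H:
  assumes "diagonalizable (br s)" "\<And>h. h \<in> H \<Longrightarrow> br s h = 0"
  shows "s \<in> H"
proof -
  have "span (insert s H) = H"
    using toral_insert[OF toral_H assms] span_superset[of "insert s H"] by (intro maximal_H) auto
  then show ?thesis using span_base[of s "insert s H"] by simp
qed

definition root_space :: "('a \<Rightarrow> complex) \<Rightarrow> 'a set" where
  "root_space \<alpha> = {x. \<forall>h\<in>H. br h x = \<alpha> h *s x}"

lemma root_spaceI: "(\<And>h. h \<in> H \<Longrightarrow> br h x = \<alpha> h *s x) \<Longrightarrow> x \<in> root_space \<alpha>"
  and root_spaceD: "x \<in> root_space \<alpha> \<Longrightarrow> h \<in> H \<Longrightarrow> br h x = \<alpha> h *s x"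
  unfolding root_space_def by blast+

lemma root_space_cong: "(\<And>h. h \<in> H \<Longrightarrow> \<alpha> h = \<beta> h) \<Longrightarrow> root_space \<alpha> = root_space \<beta>"
  unfolding root_space_def by simp

lemma subspace_root_space: "subspace (root_space \<alpha>)"
  by (simp add: subspace_def root_space_def br_add_right br_scale_right scale_right_distrib
      mult.commute)

lemma subspace_eigen_operators: "subspace {h. \<exists>c. br h v = c *s v}"
  using endo.linear_subspace_linear_preimage[OF lin_br_left subspace_span, of v "{v}"]
  by (simp add: span_singleton image_iff)

lemma span_root_spaces: "span (\<Union>\<alpha>. root_space \<alpha>) = UNIV"
proof -
  obtain F where F: "finite F" "F \<subseteq> H" "span F = H"
    using basis_subspace_exists[OF subspace_H] by metis
  have "span {v. \<forall>X\<in>br ` F. \<exists>c. X v = c *s v} = UNIV"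
  proof (rule simultaneously_diagonalizable)
    show "X (Y v) = Y (X v)" if "X \<in> br ` F" "Y \<in> br ` F" for X Y v
      using that F(2) br_H_H ad_commute by blast
  qed (use F lin_ad diagonalizable_H in auto)
  moreover have "v \<in> (\<Union>\<alpha>. root_space \<alpha>)" if "\<forall>X\<in>br ` F. \<exists>c. X v = c *s v" for v
  proof -
    have "H \<subseteq> {h. \<exists>c. br h v = c *s v}"
      unfolding F(3)[symmetric] using that by (intro span_minimal subspace_eigen_operators) auto
    then have "\<forall>h\<in>H. \<exists>c. br h v = c *s v" by blast
    from bchoice[OF this] show ?thesis unfolding root_space_def by blast
  qed
  then have "{v. \<forall>X\<in>br ` F. \<exists>c. X v = c *s v} \<subseteq> (\<Union>\<alpha>. root_space \<alpha>)" by blast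
  ultimately show ?thesis using span_mono by blast
qed

lemma br_root_space:
  assumes "x \<in> root_space \<alpha>" "y \<in> root_space \<beta>"
  shows "br x y \<in> root_space (\<alpha> + \<beta>)"
proof (rule root_spaceI)
  show "br h (br x y) = (\<alpha> + \<beta>) h *s br x y" if "h \<in> H" for h
    unfolding jacobi[of h x y] root_spaceD[OF assms(1) that] root_spaceD[OF assms(2) that]
    by (simp add: br_scale_left br_scale_right scale_left_distrib)
qed

lemma killing_root_spaces:
  assumes x: "x \<in> root_space \<alpha>" and y: "y \<in> root_space \<beta>" and h: "h \<in> H" "\<alpha> h + \<beta> h \<noteq> 0"
  shows "killing x y = 0"
proof -
  have "br x h = (- \<alpha> h) *s x" using br_anticomm[of x h] root_spaceD[OF x h(1)] by simp
  then have "- \<alpha> h * killing x y = \<beta> h * killing x y"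
    using killing_invariant[of x h y] root_spaceD[OF y h(1)]
    by (simp only: killing_scale_left killing_scale_right)
  then have "\<alpha> h * killing x y + \<beta> h * killing x y = 0" by (metis add.right_inverse minus_mult_left)
  then have "(\<alpha> h + \<beta> h) * killing x y = 0" by (simp only: distrib_right)
  then show ?thesis using h(2) by simp
qed

subsection \<open>The centralizer of the Cartan subalgebra\<close>

lemma H_in_root_space_0: "h \<in> H \<Longrightarrow> h \<in> root_space 0"
  by (rule root_spaceI) (simp add: br_H_H)

lemma br_root_space_0_H: "x \<in> root_space 0 \<Longrightarrow> h \<in> H \<Longrightarrow> br x h = 0"
  using br_anticomm[of x h] root_spaceD[of x 0 h] by simp

lemma killing_nondegenerate_on_root_space_0:
  assumes x: "x \<in> root_space 0" and "\<And>y. y \<in> root_space 0 \<Longrightarrow> killing x y = 0"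
  shows "x = 0"
proof (rule killing_nondegenerate, rule killing_zero_on_span[OF span_root_spaces])
  fix y assume "y \<in> (\<Union>\<alpha>. root_space \<alpha>)"
  then obtain \<alpha> where y: "y \<in> root_space \<alpha>" by blast
  show "killing x y = 0"
  proof (cases "\<exists>h\<in>H. \<alpha> h \<noteq> 0")
    case True
    then show ?thesis using killing_root_spaces[OF x y] by auto
  next
    case False
    then show ?thesis using y root_space_cong[of \<alpha> 0] by (intro assms(2)) simp
  qed
qed

lemma jordan_decomposition_root_space_0:
  assumes "x \<in> root_space 0"
  obtains s where "s \<in> H" "locally_nilpotent (br (x - s))"
proof -
  obtain s where "diagonalizable (br s)" "locally_nilpotent (br (x - s))"
    "\<forall>y. br x y = 0 \<longrightarrow> br s y = 0"
    using jordan_decomposition by blast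
  then show ?thesis
    using that commuting_semisimple_in_H br_root_space_0_H[OF assms] by blast
qed

lemma killing_root_space_0_H:
  assumes "x \<in> root_space 0" "locally_nilpotent (br x)" "h \<in> H"
  shows "killing x h = 0"
  using assms by (intro killing_zero_if_nilpotent_commuting br_root_space_0_H)

lemma killing_nondegenerate_on_H:
  assumes u: "u \<in> H" and orth: "\<And>h. h \<in> H \<Longrightarrow> killing u h = 0"
  shows "u = 0"
proof (rule killing_nondegenerate_on_root_space_0[OF H_in_root_space_0[OF u]])
  fix y assume y: "y \<in> root_space 0"
  then obtain s where s: "s \<in> H" "locally_nilpotent (br (y - s))"
    by (rule jordan_decomposition_root_space_0)
  then have "killing (y - s) u = 0"
    using killing_root_space_0_H subspace_diff[OF subspace_root_space y H_in_root_space_0] u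
    by blast
  then show "killing u y = 0"
    using orth[OF s(1)] by (simp add: killing_commute[of u] killing_diff_left)
qed

lemma nilpotent_if_orthogonal_H:
  assumes x: "x \<in> root_space 0" and orth: "\<And>h. h \<in> H \<Longrightarrow> killing x h = 0"
  shows "locally_nilpotent (br x)"
proof -
  obtain s where s: "s \<in> H" "locally_nilpotent (br (x - s))"
    using x by (rule jordan_decomposition_root_space_0)
  have "s = 0"
  proof (rule killing_nondegenerate_on_H[OF s(1)])
    fix h assume h: "h \<in> H"
    have "killing (x - s) h = 0"
      using subspace_diff[OF subspace_root_space x H_in_root_space_0] s h
      by (intro killing_root_space_0_H)
    then show "killing s h = 0" using orth[OF h] by (simp add: killing_diff_left)
  qed
  then show ?thesis using s(2) by simp
qed

text \<open>The elements of the centralizer orthogonal to \<open>H\<close> form a space on which the Killing form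
  vanishes on the diagonal, hence everywhere by polarisation.\<close>

lemma orthogonal_H_zero:
  assumes x: "x \<in> root_space 0" "\<And>h. h \<in> H \<Longrightarrow> killing x h = 0"
  shows "x = 0"
proof (rule killing_nondegenerate_on_root_space_0[OF x(1)])
  have self: "killing z z = 0" if "z \<in> root_space 0" "\<And>h. h \<in> H \<Longrightarrow> killing z h = 0" for z
    by (rule killing_zero_if_nilpotent_commuting[OF nilpotent_if_orthogonal_H[OF that] br_self])
  fix y assume y: "y \<in> root_space 0"
  obtain s where s: "s \<in> H" "locally_nilpotent (br (y - s))"
    using y by (rule jordan_decomposition_root_space_0)
  define n where "n = y - s"
  have n: "n \<in> root_space 0"
    unfolding n_def by (rule subspace_diff[OF subspace_root_space y H_in_root_space_0[OF s(1)]])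
  have n_orth: "killing n h = 0" if "h \<in> H" for h
    using killing_root_space_0_H[OF n _ that] s(2) unfolding n_def by blast
  have "killing (x + n) (x + n) = 0"
    using subspace_add[OF subspace_root_space x(1) n] x(2) n_orth
    by (intro self) (simp_all add: killing_add_left)
  then have "killing x n + killing n x = 0"
    by (simp add: killing_add_left killing_add_right self[OF x] self[OF n n_orth] add.commute)
  then have "killing x n = 0" by (simp add: killing_commute[of n x])
  then show "killing x y = 0" unfolding n_def using x(2)[OF s(1)] by (simp add: killing_diff_right)
qed

lemma root_space_0_eq_H: "root_space 0 = H"
proof
  show "H \<subseteq> root_space 0" using H_in_root_space_0 by blast
  show "root_space 0 \<subseteq> H"
  proof
    fix x assume x: "x \<in> root_space 0"
    then obtain s where s: "s \<in> H" "locally_nilpotent (br (x - s))"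
      by (rule jordan_decomposition_root_space_0)
    have "x - s \<in> root_space 0"
      by (rule subspace_diff[OF subspace_root_space x H_in_root_space_0[OF s(1)]])
    then have "x - s = 0" using killing_root_space_0_H[OF _ s(2)] by (intro orthogonal_H_zero)
    then show "x \<in> H" using s(1) by simp
  qed
qed

subsection \<open>Root triples\<close>

definition is_root :: "('a \<Rightarrow> complex) \<Rightarrow> bool" where
  "is_root \<alpha> \<longleftrightarrow> (\<exists>h\<in>H. \<alpha> h \<noteq> 0) \<and> (\<exists>x\<in>root_space \<alpha>. x \<noteq> 0)"

lemma is_root_if_roots: "\<alpha> \<in> roots sg br H \<Longrightarrow> is_root \<alpha>"
  unfolding roots_def is_root_def root_space_def by blast

lemma root_space_cases:
  assumes "x \<in> root_space \<alpha>"
  obtains "x = 0" | "\<And>h. h \<in> H \<Longrightarrow> \<alpha> h = 0" "x \<in> H" | "x \<noteq> 0" "is_root \<alpha>"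
  using assms root_space_cong[of \<alpha> 0] root_space_0_eq_H unfolding is_root_def by fastforce

lemma exists_killing_dual_root_vector:
  assumes x: "x \<in> root_space \<alpha>" "x \<noteq> 0"
  obtains y where "y \<in> root_space (- \<alpha>)" "killing x y \<noteq> 0"
proof -
  obtain \<beta> y where y: "y \<in> root_space \<beta>" "killing x y \<noteq> 0"
    using killing_nondegenerate[of x] killing_zero_on_span[OF span_root_spaces, of x] x(2) by blast
  have "\<beta> h = (- \<alpha>) h" if "h \<in> H" for h
    using killing_root_spaces[OF x(1) y(1) that] y(2) by (auto simp: add_eq_0_iff)
  then show ?thesis using that y root_space_cong[of \<beta> "- \<alpha>"] by blast
qed

lemma br_opposite_root_spaces:
  assumes x: "x \<in> root_space \<alpha>" and y: "y \<in> root_space (- \<alpha>)"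
  shows "br x y \<in> H" "h \<in> H \<Longrightarrow> killing (br x y) h = killing x y * \<alpha> h"
proof -
  show "br x y \<in> H" using br_root_space[OF x y] root_space_0_eq_H by simp
  show "killing (br x y) h = killing x y * \<alpha> h" if h: "h \<in> H"
  proof -
    have "br y h = \<alpha> h *s y" using br_anticomm[of y h] root_spaceD[OF y h] by simp
    then show ?thesis by (simp add: killing_invariant killing_scale_right)
  qed
qed

text \<open>If \<open>\<alpha>\<close> vanished at \<open>t = [x, y]\<close>, then \<open>ad t = [ad x, ad y]\<close> would be orthogonal to every
  operator commuting with \<open>ad y\<close>, in particular to its own conjugate.\<close>

lemma root_nonzero_at_bracket:
  assumes x: "x \<in> root_space \<alpha>" and y: "y \<in> root_space (- \<alpha>)" and "br x y \<noteq> 0"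
  shows "\<alpha> (br x y) \<noteq> 0"
proof
  define t where "t = br x y"
  assume "\<alpha> (br x y) = 0"
  have t: "t \<in> H" unfolding t_def by (rule br_opposite_root_spaces(1)[OF x y])
  have "br y t = 0"
    using br_anticomm[of y t] root_spaceD[OF y t] \<open>\<alpha> (br x y) = 0\<close> by (simp add: t_def)
  define D where "D = diag_op cnj (br t)"
  have "lin D" unfolding D_def by (rule lin_diag_op[OF lin_ad])
  have "br y (D v) = D (br y v)" for v
    unfolding D_def by (rule diag_op_commute[OF lin_ad lin_ad ad_commute[OF \<open>br y t = 0\<close>]])
  moreover have "trace (\<lambda>v. br t (D v)) = trace (\<lambda>v. br x (br y (D v) - D (br y v)))"
    unfolding t_def ad_br by (rule trace_commutator_cyclic[OF lin_ad lin_ad \<open>lin D\<close>])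
  ultimately have "trace (\<lambda>v. br t (D v)) = 0" by simp
  then have "locally_nilpotent (br t)"
    unfolding D_def by (rule locally_nilpotent_if_trace_cnj_zero[OF lin_ad])
  from diagonalizable_locally_nilpotent[OF lin_ad diagonalizable_H[OF t] this]
  have "t = 0" by (rule center_zero)
  with assms(3) show False by (simp add: t_def)
qed

definition real_cartan :: "'a set" where
  "real_cartan = {h\<in>H. \<forall>\<gamma>. \<forall>z\<in>root_space \<gamma>. \<exists>r::real. br h z = of_real r *s z}"

lemma real_cartanD: "h \<in> real_cartan \<Longrightarrow> h \<in> H"
  unfolding real_cartan_def by blast

lemma real_cartan_eigenvalue:
  assumes "h \<in> real_cartan" "z \<in> root_space \<gamma>"
  obtains r :: real where "br h z = of_real r *s z"
  using assms unfolding real_cartan_def by blast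

lemma real_cartan_zero: "0 \<in> real_cartan"
  unfolding real_cartan_def using subspace_0[OF subspace_H] by (auto intro!: exI[of _ "0::real"])

lemma real_cartan_add:
  assumes "h \<in> real_cartan" "h' \<in> real_cartan"
  shows "h + h' \<in> real_cartan"
proof -
  have "\<exists>r::real. br (h + h') z = of_real r *s z" if z: "z \<in> root_space \<gamma>" for \<gamma> z
  proof -
    obtain r r' :: real where "br h z = of_real r *s z" "br h' z = of_real r' *s z"
      using assms real_cartan_eigenvalue[OF _ z] by metis
    then show ?thesis
      by (intro exI[of _ "r + r'"]) (simp add: br_add_left scale_left_distrib)
  qed
  then show ?thesis
    using assms subspace_add[OF subspace_H] unfolding real_cartan_def by blast
qed

lemma real_cartan_scale:
  assumes "h \<in> real_cartan"
  shows "of_real c *s h \<in> real_cartan"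
proof -
  have "\<exists>r::real. br (of_real c *s h) z = of_real r *s z" if z: "z \<in> root_space \<gamma>" for \<gamma> z
  proof -
    obtain r :: real where "br h z = of_real r *s z" using real_cartan_eigenvalue[OF assms z] .
    then show ?thesis by (intro exI[of _ "c * r"]) (simp add: br_scale_left)
  qed
  then show ?thesis
    using assms subspace_scale[OF subspace_H] unfolding real_cartan_def by blast
qed

lemma root_real_on_real_cartan:
  assumes "h \<in> real_cartan" "is_root \<alpha>"
  obtains r :: real where "\<alpha> h = of_real r"
proof -
  obtain z where z: "z \<in> root_space \<alpha>" "z \<noteq> 0" using assms(2) unfolding is_root_def by blast
  obtain r :: real where "br h z = of_real r *s z" using real_cartan_eigenvalue[OF assms(1) z(1)] .
  then show ?thesis using that root_spaceD[OF z(1) real_cartanD[OF assms(1)]] z(2) by simp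
qed

lemma killing_pos_on_real_cartan:
  assumes h: "h \<in> real_cartan" "h \<noteq> 0"
  obtains q :: real where "q > 0" "killing h h = of_real q"
proof -
  have "\<exists>c. cnj c = c \<and> br h v = c *s v" if v: "v \<in> root_space \<gamma>" for \<gamma> v
  proof -
    obtain r :: real where "br h v = of_real r *s v" using real_cartan_eigenvalue[OF h(1) v] .
    then show ?thesis by (intro exI[of _ "of_real r"]) simp
  qed
  then have "(\<Union>\<gamma>. root_space \<gamma>) \<subseteq> {v. \<exists>c. cnj c = c \<and> br h v = c *s v}" by blast
  from span_mono[OF this] have "diag_op cnj (br h) = br h"
    unfolding span_root_spaces by (intro diag_op_eq_self lin_ad) blast
  then obtain q :: real where q: "q \<ge> 0" "killing h h = of_real q"
      "q = 0 \<Longrightarrow> locally_nilpotent (br h)"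
    using trace_compose_diag_op_cnj[OF lin_ad, of h] unfolding killing_def by metis
  have "diagonalizable (br h)" using diagonalizable_H real_cartanD[OF h(1)] by blast
  then have "q \<noteq> 0"
    using q(3) diagonalizable_locally_nilpotent[OF lin_ad] center_zero h(2) by blast
  then show ?thesis using that q(1,2) by simp
qed

definition root_triple :: "('a \<Rightarrow> complex) \<Rightarrow> 'a \<Rightarrow> 'a \<Rightarrow> 'a \<Rightarrow> bool" where
  "root_triple \<alpha> e f h \<longleftrightarrow> e \<in> root_space \<alpha> \<and> f \<in> root_space (- \<alpha>) \<and> sl2_triple e f h
     \<and> h \<in> real_cartan \<and> (\<exists>k>0. \<forall>h'\<in>H. killing h h' = of_real k * \<alpha> h')"

lemma exists_sl2_triple:
  assumes x: "x \<in> root_space \<alpha>" "x \<noteq> 0" and "is_root \<alpha>"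
  obtains f h k where "f \<in> root_space (- \<alpha>)" "h \<in> H" "sl2_triple x f h"
    "\<And>h'. h' \<in> H \<Longrightarrow> killing h h' = k * \<alpha> h'"
proof -
  obtain y where y: "y \<in> root_space (- \<alpha>)" "killing x y \<noteq> 0"
    by (rule exists_killing_dual_root_vector[OF x])
  define t where "t = br x y"
  note t = br_opposite_root_spaces[OF x(1) y(1), folded t_def]
  have "t \<noteq> 0" using t(2) y(2) assms(3) unfolding is_root_def by auto
  then have nz: "\<alpha> t \<noteq> 0" unfolding t_def by (rule root_nonzero_at_bracket[OF x(1) y(1)])
  define c where "c = 2 / \<alpha> t"
  show ?thesis
  proof (rule that)
    show "c *s y \<in> root_space (- \<alpha>)" by (rule subspace_scale[OF subspace_root_space y(1)])
    show "c *s t \<in> H" by (rule subspace_scale[OF subspace_H t(1)])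
    show "sl2_triple x (c *s y) (c *s t)"
      unfolding sl2_triple_def using nz root_spaceD[OF x(1) t(1)] root_spaceD[OF y(1) t(1)]
      by (simp add: br_scale_right br_scale_left t_def[symmetric] c_def)
    show "killing (c *s t) h' = (c * killing x y) * \<alpha> h'" if "h' \<in> H" for h'
      by (simp add: killing_scale_left t(2)[OF that])
  qed
qed

lemma exists_root_triple:
  assumes x: "x \<in> root_space \<alpha>" "x \<noteq> 0" and "is_root \<alpha>"
  obtains f h where "root_triple \<alpha> x f h"
proof -
  obtain f h k where f: "f \<in> root_space (- \<alpha>)" and h: "h \<in> H" and triple: "sl2_triple x f h"
    and k: "\<And>h'. h' \<in> H \<Longrightarrow> killing h h' = k * \<alpha> h'"
    using exists_sl2_triple[OF assms] by metis
  interpret sl2_rep sg Bg "br x" "br f" "br h"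
    by (rule sl2_rep_of_lie_module[OF triple fd_linear_operators_axioms adjoint_lie_module])
  have "\<exists>r::real. br h z = of_real r *s z" if z: "z \<in> root_space \<gamma>" for z \<gamma>
  proof (cases "z = 0")
    case False
    then have "\<gamma> h \<in> \<int>" by (rule weight_integral[OF _ root_spaceD[OF z h]])
    then show ?thesis using root_spaceD[OF z h] by (metis Ints_cases of_real_of_int_eq)
  qed simp
  then have h_real: "h \<in> real_cartan" using h unfolding real_cartan_def by blast
  have "br h x = 2 *s x" using triple unfolding sl2_triple_def by blast
  then have "\<alpha> h = 2" "h \<noteq> 0" using root_spaceD[OF x(1) h] x(2) by auto
  then obtain q :: real where q: "q > 0" "killing h h = of_real q"
    using killing_pos_on_real_cartan[OF h_real] by metis
  then have "k = of_real (q / 2)" using k[OF h] \<open>\<alpha> h = 2\<close> by (simp add: field_simps)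
  then have "root_triple \<alpha> x f h"
    unfolding root_triple_def using x(1) f triple h_real k q(1) by (auto intro!: exI[of _ "q / 2"])
  then show ?thesis by (rule that)
qed

lemma is_root_obtains_root_triple:
  assumes "is_root \<alpha>"
  obtains e f h where "root_triple \<alpha> e f h" "e \<noteq> 0"
  using assms exists_root_triple[OF _ _ assms] unfolding is_root_def by metis

lemma is_root_uminus:
  assumes "is_root \<alpha>"
  shows "is_root (- \<alpha>)"
proof -
  obtain e f h where triple: "root_triple \<alpha> e f h" "e \<noteq> 0"
    using is_root_obtains_root_triple[OF assms] .
  then have "f \<noteq> 0" unfolding root_triple_def sl2_triple_def by auto
  then show ?thesis using triple(1) assms unfolding root_triple_def is_root_def by auto
qed

lemma exists_killing_dual_root_sum:
  assumes "\<And>\<beta>. \<beta> \<in> set \<beta>s \<Longrightarrow> is_root \<beta>"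
  shows "\<exists>t\<in>real_cartan. \<forall>h\<in>H. killing t h = sum_list \<beta>s h"
  using assms
proof (induction \<beta>s)
  case Nil
  show ?case by (rule bexI[OF _ real_cartan_zero]) simp
next
  case (Cons \<beta> \<beta>s)
  obtain t where t: "t \<in> real_cartan" "\<forall>h\<in>H. killing t h = sum_list \<beta>s h"
    using Cons by auto
  obtain e f h where "root_triple \<beta> e f h"
    using is_root_obtains_root_triple Cons.prems by (metis list.set_intros(1))
  then obtain k where h: "h \<in> real_cartan" and k: "k > 0" "\<forall>h'\<in>H. killing h h' = of_real k * \<beta> h'"
    unfolding root_triple_def by blast
  have "of_real (1 / k) *s h + t \<in> real_cartan" by (intro real_cartan_add real_cartan_scale h t(1))
  moreover have "\<forall>h'\<in>H. killing (of_real (1 / k) *s h + t) h' = sum_list (\<beta> # \<beta>s) h'"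
    using k t(2) by (simp add: killing_add_left killing_scale_left)
  ultimately show ?case by blast
qed

text \<open>With \<open>t\<close> dual to the sum of the roots, \<open>\<kappa>(t, t) > 0\<close> is the sum of the values of the
  summands at \<open>t\<close>; some summand is thus positive at \<open>t\<close>, and its coroot is a positive multiple of
  its dual.\<close>

lemma positive_summand:
  assumes roots: "\<And>\<beta>. \<beta> \<in> set \<beta>s \<Longrightarrow> is_root \<beta>" and h0: "h0 \<in> H" "sum_list \<beta>s h0 \<noteq> 0"
  obtains \<beta> e f h and r :: real
    where "\<beta> \<in> set \<beta>s" "root_triple \<beta> e f h" "sum_list \<beta>s h = of_real r" "r > 0"
proof -
  obtain t where t: "t \<in> real_cartan" "\<And>h. h \<in> H \<Longrightarrow> killing t h = sum_list \<beta>s h"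
    using exists_killing_dual_root_sum[OF roots] by blast
  have "t \<noteq> 0" using t(2)[OF h0(1)] h0(2) by auto
  then obtain q :: real where q: "q > 0" "killing t t = of_real q"
    using killing_pos_on_real_cartan[OF t(1)] by blast
  have "Re (sum_list \<beta>s t) = (\<Sum>\<beta>\<leftarrow>\<beta>s. Re (\<beta> t))" by (induction \<beta>s) simp_all
  then have "(\<Sum>\<beta>\<leftarrow>\<beta>s. Re (\<beta> t)) > 0" using q t(2)[OF real_cartanD[OF t(1)]] by simp
  then obtain \<beta> where \<beta>: "\<beta> \<in> set \<beta>s" "Re (\<beta> t) > 0"
    using sum_list_nonpos[of "map (\<lambda>\<beta>. Re (\<beta> t)) \<beta>s"] by force
  obtain r :: real where r: "\<beta> t = of_real r"
    using root_real_on_real_cartan[OF t(1) roots[OF \<beta>(1)]] .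
  obtain e f h where triple: "root_triple \<beta> e f h"
    using is_root_obtains_root_triple[OF roots[OF \<beta>(1)]] .
  then obtain k where h: "h \<in> H" and k: "k > 0" "\<forall>h'\<in>H. killing h h' = of_real k * \<beta> h'"
    unfolding root_triple_def using real_cartanD by blast
  have "sum_list \<beta>s h = killing h t" using t(2)[OF h] killing_commute by simp
  also have "\<dots> = of_real (k * r)" using k(2) real_cartanD[OF t(1)] r by simp
  finally have "sum_list \<beta>s h = of_real (k * r)" .
  moreover have "k * r > 0" using \<beta>(2) r k(1) by simp
  ultimately show ?thesis using that \<beta>(1) triple by blast
qed

subsection \<open>Sums of roots\<close>

definition root_sums :: "('a \<Rightarrow> complex) set" where
  "root_sums = {sum_list \<beta>s |\<beta>s. \<forall>\<beta>\<in>set \<beta>s. is_root \<beta>}"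

lemma zero_in_root_sums: "0 \<in> root_sums"
  unfolding root_sums_def by (intro CollectI exI[of _ "[]"]) simp

lemma root_in_root_sums: "is_root \<alpha> \<Longrightarrow> \<alpha> \<in> root_sums"
  unfolding root_sums_def by (intro CollectI exI[of _ "[\<alpha>]"]) simp

lemma add_in_root_sums:
  assumes "\<mu> \<in> root_sums" "\<nu> \<in> root_sums"
  shows "\<mu> + \<nu> \<in> root_sums"
proof -
  obtain \<alpha>s \<beta>s where "\<mu> = sum_list \<alpha>s" "\<nu> = sum_list \<beta>s" "\<forall>\<beta>\<in>set (\<alpha>s @ \<beta>s). is_root \<beta>"
    using assms unfolding root_sums_def by fastforce
  then show ?thesis unfolding root_sums_def by (intro CollectI exI[of _ "\<alpha>s @ \<beta>s"]) simp
qed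

lemma sum_in_root_sums: "(\<And>i. i \<in> I \<Longrightarrow> g i \<in> root_sums) \<Longrightarrow> sum g I \<in> root_sums"
  by (induction I rule: infinite_finite_induct) (simp_all add: zero_in_root_sums add_in_root_sums)

lemma of_nat_mult_in_root_sums:
  assumes "is_root \<alpha>"
  shows "(\<lambda>x. of_nat n * \<alpha> x) \<in> root_sums"
proof -
  have "(\<lambda>x. of_nat n * \<alpha> x) = (\<Sum>i<n. \<alpha>)"
    by (induction n) (auto simp: fun_eq_iff algebra_simps)
  then show ?thesis using sum_in_root_sums[of "{..<n}" "\<lambda>_. \<alpha>"] root_in_root_sums[OF assms] by simp
qed

lemma of_int_mult_in_root_sums:
  assumes "is_root \<alpha>"
  shows "(\<lambda>x. of_int c * \<alpha> x) \<in> root_sums"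
proof (cases c)
  case (nonneg n)
  then show ?thesis using of_nat_mult_in_root_sums[OF assms, of n] by simp
next
  case (neg n)
  have "(\<lambda>x. of_int c * \<alpha> x) = (\<lambda>x. of_nat (Suc n) * (- \<alpha>) x)"
    by (simp add: neg fun_eq_iff algebra_simps)
  then show ?thesis using of_nat_mult_in_root_sums[OF is_root_uminus[OF assms], of "Suc n"] by simp
qed

lemma root_lattice_subset_root_sums: "root_lattice sg br H \<subseteq> root_sums"
proof
  fix \<nu> assume "\<nu> \<in> root_lattice sg br H"
  then obtain c :: "('a \<Rightarrow> complex) \<Rightarrow> int"
    where "\<nu> = (\<lambda>x. \<Sum>\<alpha>\<in>roots sg br H. of_int (c \<alpha>) * \<alpha> x)"
    unfolding root_lattice_def by blast
  also have "(\<lambda>x. \<Sum>\<alpha>\<in>I. of_int (c \<alpha>) * \<alpha> x) = (\<Sum>\<alpha>\<in>I. (\<lambda>x. of_int (c \<alpha>) * \<alpha> x))" for I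
    by (induction I rule: infinite_finite_induct) (simp_all add: fun_eq_iff)
  finally show "\<nu> \<in> root_sums"
    by (simp only: sum_in_root_sums of_int_mult_in_root_sums is_root_if_roots)
qed

lemma span_root_spaces_root_sums: "span (\<Union>\<beta>\<in>root_sums. root_space \<beta>) = UNIV"
proof -
  have "x \<in> span (\<Union>\<beta>\<in>root_sums. root_space \<beta>)" if "x \<in> root_space \<alpha>" for x \<alpha>
    using that
  proof (cases rule: root_space_cases)
    case 1
    then show ?thesis by (simp add: span_zero)
  next
    case 2
    then show ?thesis using H_in_root_space_0 zero_in_root_sums by (intro span_base) blast
  next
    case 3
    then show ?thesis using that root_in_root_sums by (intro span_base) blast
  qed
  then have "span (\<Union>\<alpha>. root_space \<alpha>) \<subseteq> span (\<Union>\<beta>\<in>root_sums. root_space \<beta>)"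
    by (intro span_minimal) auto
  then show ?thesis unfolding span_root_spaces by blast
qed

end

section \<open>Overshears\<close>

lemma fin_dim_obtain_basis:
  assumes "fin_dim s"
  obtains B where "complex_fd_operators s B"
proof -
  interpret vector_space s using assms unfolding fin_dim_def by blast
  obtain C where C: "finite C" "span C = UNIV" using assms unfolding fin_dim_def by blast
  obtain B where B: "B \<subseteq> C" "independent B" "C \<subseteq> span B" using maximal_independent_subset by blast
  have "span B = UNIV" using B C(2) span_eq[of B C] span_superset by blast
  then have "complex_fd_operators s B"
    using B C(1) finite_subset by unfold_locales auto
  then show ?thesis by (rule that)
qed

lemma fin_dim_tensor_product:
  assumes "fin_dim sv" "fin_dim sg" "tensor_product sv sg st tp"
  shows "fin_dim st"
proof -
  obtain A B where A: "finite A" "module.span sv A = UNIV"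
    and B: "finite B" "module.span sg B = UNIV"
    using assms(1,2) unfolding fin_dim_def by blast
  interpret T: vector_space st using assms(3) unfolding tensor_product_def by blast
  let ?C = "(\<lambda>(a, b). tp a b) ` (A \<times> B)"
  have "tp v x \<in> T.span ?C" for v x
  proof (rule bilinear_span_into_subspace[where A = A and B = B])
    show "tp a b \<in> T.span ?C" if "a \<in> A" "b \<in> B" for a b
      using that by (intro T.span_base) blast
  qed (use assms(3) A(2) B(2) in \<open>auto simp: tensor_product_def\<close>)
  then have "T.span {tp v x |v x. True} \<subseteq> T.span ?C" by (intro T.span_minimal) auto
  then have "T.span ?C = UNIV" using assms(3) unfolding tensor_product_def by blast
  then show ?thesis
    unfolding fin_dim_def using A(1) B(1)
    by (intro conjI exI[of _ ?C] T.vector_space_axioms) simp_all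
qed

locale overshear_module = cartan_lie_algebra +
  V: fd_linear_operators sv Bv + T: fd_linear_operators st Bt
  for sv :: "complex \<Rightarrow> 'v::ab_group_add \<Rightarrow> 'v" and Bv
    and st :: "complex \<Rightarrow> 't::ab_group_add \<Rightarrow> 't" and Bt +
  fixes rho :: "'a \<Rightarrow> 'v \<Rightarrow> 'v" and tp :: "'v \<Rightarrow> 'a \<Rightarrow> 't" and sigma :: "'a \<Rightarrow> 't \<Rightarrow> 't"
  assumes lie_module_rho: "lie_module sg br sv rho"
    and tensor_product: "tensor_product sv sg st tp"
    and lin_sigma: "\<And>x. T.lin (sigma x)"
    and sigma_tp: "\<And>x v y. sigma x (tp v y) = tp (rho x v) y + tp v (br x y)"
begin

sublocale GV: vector_space_pair sg sv ..
sublocale GT: vector_space_pair sg st ..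
sublocale VT: vector_space_pair sv st ..

lemma lin_rho: "V.lin (rho x)" and lin_rho_left: "Vector_Spaces.linear sg sv (\<lambda>x. rho x v)"
  and rho_br: "rho (br x y) v = rho x (rho y v) - rho y (rho x v)"
  using lie_module_rho unfolding lie_module_def by blast+

lemma lin_tp: "Vector_Spaces.linear sg st (tp v)"
  and lin_tp_left: "Vector_Spaces.linear sv st (\<lambda>v. tp v x)"
  and span_tp: "T.span {tp v x |v x. True} = UNIV"
  using tensor_product unfolding tensor_product_def by blast+

lemmas rho_zero_right [simp] = V.endo.linear_0[OF lin_rho]
  and rho_scale_right = V.endo.linear_scale[OF lin_rho]
  and rho_add_left = GV.linear_add[OF lin_rho_left]
  and rho_scale_left = GV.linear_scale[OF lin_rho_left]
  and sigma_add = T.endo.linear_add[OF lin_sigma]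
  and sigma_scale = T.endo.linear_scale[OF lin_sigma]
  and tp_zero_right [simp] = GT.linear_0[OF lin_tp]
  and tp_add_right = GT.linear_add[OF lin_tp]
  and tp_diff_right = GT.linear_diff[OF lin_tp]
  and tp_minus_right = GT.linear_neg[OF lin_tp]
  and tp_scale_right = GT.linear_scale[OF lin_tp]
  and tp_add_left = VT.linear_add[OF lin_tp_left]
  and tp_diff_left = VT.linear_diff[OF lin_tp_left]
  and tp_scale_left = VT.linear_scale[OF lin_tp_left]

lemma lin_eqI_tp:
  assumes "T.lin f" "T.lin g" "\<And>v x. f (tp v x) = g (tp v x)"
  shows "f t = g t"
  using T.endo.linear_eq_on[OF assms(1,2), of t "{tp v x |v x. True}"] assms(3) span_tp by auto

lemma lie_module_sigma: "lie_module sg br st sigma"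
proof -
  have "sigma (x + y) t = sigma x t + sigma y t" for x y t
  proof (rule lin_eqI_tp[where f = "sigma (x + y)"])
    show "sigma (x + y) (tp v z) = sigma x (tp v z) + sigma y (tp v z)" for v z
      by (simp add: sigma_tp rho_add_left br_add_left tp_add_left tp_add_right algebra_simps)
  qed (intro lin_sigma T.endo.linear_compose_add)+
  moreover have "sigma (c *s x) t = st c (sigma x t)" for c x t
  proof (rule lin_eqI_tp[where f = "sigma (c *s x)"])
    show "sigma (c *s x) (tp v z) = st c (sigma x (tp v z))" for v z
      by (simp add: sigma_tp rho_scale_left br_scale_left tp_scale_left tp_scale_right
          T.scale_right_distrib)
  qed (intro lin_sigma T.endo.linear_compose_scale_right)+
  moreover have "sigma (br x y) t = sigma x (sigma y t) - sigma y (sigma x t)" for x y t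
  proof (rule lin_eqI_tp[where f = "sigma (br x y)"])
    show "sigma (br x y) (tp v z) = sigma x (sigma y (tp v z)) - sigma y (sigma x (tp v z))" for v z
      by (simp add: sigma_tp sigma_add rho_br ad_br tp_diff_left tp_diff_right)
  qed (intro lin_sigma T.endo.linear_compose_sub T.lin_compose[OF lin_sigma lin_sigma])+
  ultimately show ?thesis
    unfolding lie_module_def Vector_Spaces.linear_iff
    using vector_space_axioms T.vector_space_axioms by (auto simp: sigma_add sigma_scale)
qed

lemmas sl2_rep_rho = sl2_rep_of_lie_module[OF _ V.fd_linear_operators_axioms lie_module_rho]
  and sl2_rep_sigma = sl2_rep_of_lie_module[OF _ T.fd_linear_operators_axioms lie_module_sigma]

definition overshear_submodule :: "'t set" where
  "overshear_submodule = gen_submodule st sigma {tp v x | v x. rho x (rho x v) = 0}"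

lemma subspace_overshear_submodule: "T.subspace overshear_submodule"
  unfolding overshear_submodule_def gen_submodule_def invariant_subspace_def
  by (intro T.subspace_Inter) blast

lemma sigma_overshear_submodule: "t \<in> overshear_submodule \<Longrightarrow> sigma x t \<in> overshear_submodule"
  unfolding overshear_submodule_def gen_submodule_def invariant_subspace_def by blast

lemma overshear_in_overshear_submodule: "rho x (rho x v) = 0 \<Longrightarrow> tp v x \<in> overshear_submodule"
  unfolding overshear_submodule_def gen_submodule_def by blast

subsection \<open>Weight-two vectors of an \<open>sl\<^sub>2\<close>-triple\<close>

lemma sigma_pow_tp:
  assumes "sl2_triple e f h"
  shows "(sigma f ^^ Suc k) (tp u h)
    = tp ((rho f ^^ Suc k) u) h + st (2 * of_nat (Suc k)) (tp ((rho f ^^ k) u) f)"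
proof -
  have fh: "br f h = 2 *s f" using assms br_anticomm[of f h] by (simp add: sl2_triple_def)
  show ?thesis
  proof (induction k)
    case 0
    show ?case by (simp add: sigma_tp fh tp_scale_right)
  next
    case (Suc k)
    let ?w = "(rho f ^^ Suc k) u" and ?c = "2 * of_nat (Suc k) :: complex"
    have "(sigma f ^^ Suc (Suc k)) (tp u h) = sigma f (tp ?w h + st ?c (tp ((rho f ^^ k) u) f))"
      using Suc.IH by simp
    also have "\<dots> = tp (rho f ?w) h + (st 2 (tp ?w f) + st ?c (tp ?w f))"
      by (simp add: sigma_add sigma_scale sigma_tp fh tp_scale_right)
    also have "st 2 (tp ?w f) + st ?c (tp ?w f) = st (2 * of_nat (Suc (Suc k))) (tp ?w f)"
      by (simp only: T.scale_left_distrib[symmetric]) simp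
    finally show ?case by simp
  qed
qed

lemma lowered_highest_tensor_in_overshear_submodule:
  assumes triple: "sl2_triple e f h" and u: "rho e u = 0" "rho h u = sv (of_nat (2 + 2 * n)) u"
  shows "tp ((rho f ^^ n) u) f \<in> overshear_submodule" (is "_ \<in> ?U")
proof -
  interpret R: sl2_rep sv Bv "rho e" "rho f" "rho h" by (rule sl2_rep_rho[OF triple])
  note sub = subspace_overshear_submodule
  have "tp u e \<in> ?U" by (rule overshear_in_overshear_submodule) (simp add: u(1))
  moreover have "tp (rho f u) e \<in> ?U"
    by (rule overshear_in_overshear_submodule) (simp add: R.EF u rho_scale_right)
  moreover have "tp u h = tp (rho f u) e - sigma f (tp u e)"
    using triple br_anticomm[of f e] by (simp add: sl2_triple_def sigma_tp tp_minus_right)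
  ultimately have "tp u h \<in> ?U" using T.subspace_diff[OF sub] sigma_overshear_submodule by metis
  then have "(sigma f ^^ k) (tp u h) \<in> ?U" for k
    by (induction k) (simp_all add: sigma_overshear_submodule)
  moreover have "tp ((rho f ^^ Suc n) u) h \<in> ?U"
    using R.weight_F_pow[OF u(2), of "Suc n"]
    by (intro overshear_in_overshear_submodule) (simp del: funpow.simps)
  ultimately have "st (2 * of_nat (Suc n)) (tp ((rho f ^^ n) u) f) \<in> ?U"
    using T.subspace_diff[OF sub] sigma_pow_tp[OF triple, of n u] by (metis add_diff_cancel_left')
  from T.subspace_scale[OF sub this, of "inverse (2 * of_nat (Suc n))"] show ?thesis
    by (simp del: of_nat_Suc)
qed

lemma weight_two_tensor_in_overshear_submodule:
  assumes triple: "sl2_triple e f h" and v: "rho h v = sv 2 v"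
  shows "tp v f \<in> overshear_submodule"
proof -
  interpret R: sl2_rep sv Bv "rho e" "rho f" "rho h" by (rule sl2_rep_rho[OF triple])
  show ?thesis
    by (rule linear_span_into_subspace[OF lin_tp_left subspace_overshear_submodule _
          R.weight_in_span_lowered_highest[of v 2]])
       (use v lowered_highest_tensor_in_overshear_submodule[OF triple] in auto)
qed

subsection \<open>Weight spaces\<close>

definition weight_space :: "('a \<Rightarrow> complex) \<Rightarrow> 'v set" where
  "weight_space \<nu> = {v. \<forall>h\<in>H. rho h v = sv (\<nu> h) v}"

lemma weight_spaceD: "v \<in> weight_space \<nu> \<Longrightarrow> h \<in> H \<Longrightarrow> rho h v = sv (\<nu> h) v"
  unfolding weight_space_def by blast

lemma rho_weight_space:
  assumes "x \<in> root_space \<alpha>" "v \<in> weight_space \<nu>"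
  shows "rho x v \<in> weight_space (\<nu> + \<alpha>)"
  unfolding weight_space_def
proof (intro CollectI ballI)
  fix h assume h: "h \<in> H"
  have "rho h (rho x v) = rho (br h x) v + rho x (rho h v)" by (simp add: rho_br)
  also have "\<dots> = sv ((\<nu> + \<alpha>) h) (rho x v)"
    unfolding root_spaceD[OF assms(1) h] weight_spaceD[OF assms(2) h]
    by (simp add: rho_scale_left rho_scale_right V.scale_left_distrib add.commute)
  finally show "rho h (rho x v) = sv ((\<nu> + \<alpha>) h) (rho x v)" .
qed

lemma span_weight_spaces:
  assumes "irreducible_module sv rho" "\<mu> \<in> root_sums" "\<mu> \<in> weights H sv rho"
  shows "V.span (\<Union>\<nu>\<in>root_sums. weight_space \<nu>) = UNIV"
proof -
  let ?S = "\<Union>\<nu>\<in>root_sums. weight_space \<nu>"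
  have "rho x w \<in> V.span ?S" if "w \<in> V.span ?S" for x w
  proof (rule bilinear_span_into_subspace[OF lin_rho lin_rho_left V.subspace_span _ _ that])
    show "x \<in> span (\<Union>\<beta>\<in>root_sums. root_space \<beta>)" by (simp add: span_root_spaces_root_sums)
    show "rho x w \<in> V.span ?S" if xw: "x \<in> (\<Union>\<beta>\<in>root_sums. root_space \<beta>)" "w \<in> ?S" for x w
    proof -
      obtain \<beta> \<nu> where "\<beta> \<in> root_sums" "x \<in> root_space \<beta>" "\<nu> \<in> root_sums" "w \<in> weight_space \<nu>"
        using xw by blast
      then have "\<nu> + \<beta> \<in> root_sums" "rho x w \<in> weight_space (\<nu> + \<beta>)"
        by (simp_all add: add_in_root_sums rho_weight_space)
      then show ?thesis by (intro V.span_base) blast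
    qed
  qed
  then have "invariant_subspace sv rho (V.span ?S)"
    unfolding invariant_subspace_def by simp
  then have "V.span ?S = {0} \<or> V.span ?S = UNIV"
    using assms(1) unfolding irreducible_module_def by blast
  moreover obtain v where "v \<noteq> 0" "v \<in> weight_space \<mu>"
    using assms(3) unfolding weights_def weight_space_def by blast
  moreover from this have "v \<in> V.span ?S" using assms(2) by (intro V.span_base) blast
  ultimately show ?thesis by blast
qed

definition tensor_weight_space :: "('a \<Rightarrow> complex) \<Rightarrow> 't set" where
  "tensor_weight_space \<nu>
    = T.span {tp v x |v x. \<exists>\<alpha>. v \<in> weight_space (\<nu> - \<alpha>) \<and> x \<in> root_space \<alpha>}"

lemma tp_in_tensor_weight_space:
  assumes "v \<in> weight_space \<nu>" "x \<in> root_space \<alpha>"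
  shows "tp v x \<in> tensor_weight_space (\<nu> + \<alpha>)"
proof -
  have "v \<in> weight_space (\<nu> + \<alpha> - \<alpha>)" using assms(1) by simp
  then show ?thesis unfolding tensor_weight_space_def using assms(2) by (intro T.span_base) blast
qed

lemma sigma_tensor_weight_space:
  assumes x: "x \<in> root_space \<beta>" and t: "t \<in> tensor_weight_space \<nu>"
  shows "sigma x t \<in> tensor_weight_space (\<nu> + \<beta>)"
proof -
  have sub: "T.subspace (tensor_weight_space (\<nu> + \<beta>))" unfolding tensor_weight_space_def by simp
  have pure: "sigma x (tp v y) \<in> tensor_weight_space (\<nu> + \<beta>)"
    if v: "v \<in> weight_space (\<nu> - \<alpha>)" and y: "y \<in> root_space \<alpha>" for v y \<alpha>
  proof -
    have "tp (rho x v) y \<in> tensor_weight_space (\<nu> + \<beta>)"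
      using tp_in_tensor_weight_space[OF rho_weight_space[OF x v] y] by (simp add: algebra_simps)
    moreover have "tp v (br x y) \<in> tensor_weight_space (\<nu> + \<beta>)"
      using tp_in_tensor_weight_space[OF v br_root_space[OF x y]] by (simp add: algebra_simps)
    ultimately show ?thesis unfolding sigma_tp by (rule T.subspace_add[OF sub])
  qed
  show ?thesis
    by (rule linear_span_into_subspace[OF lin_sigma sub _ t[unfolded tensor_weight_space_def]])
       (use pure in blast)
qed

lemma sigma_H_tensor_weight_space:
  assumes h: "h \<in> H" and t: "t \<in> tensor_weight_space \<nu>"
  shows "sigma h t = st (\<nu> h) t"
proof -
  note t_in_span = t[unfolded tensor_weight_space_def]
  show ?thesis
  proof (rule T.endo.linear_eq_on[OF lin_sigma T.linear_scale_self t_in_span], safe)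
    fix v x \<alpha> assume v: "v \<in> weight_space (\<nu> - \<alpha>)" and x: "x \<in> root_space \<alpha>"
    show "sigma h (tp v x) = st (\<nu> h) (tp v x)"
      unfolding sigma_tp weight_spaceD[OF v h] root_spaceD[OF x h]
      by (simp add: tp_scale_left tp_scale_right T.scale_left_diff_distrib)
  qed
qed

lemma tensor_weight_space_zero_subset:
  assumes \<nu>: "\<And>h. h \<in> H \<Longrightarrow> \<nu> h = 0"
  shows "tensor_weight_space \<nu> \<subseteq> overshear_submodule"
  unfolding tensor_weight_space_def
proof (rule T.span_minimal[OF _ subspace_overshear_submodule], safe)
  fix v x \<alpha> assume v: "v \<in> weight_space (\<nu> - \<alpha>)" and x: "x \<in> root_space \<alpha>"
  show "tp v x \<in> overshear_submodule" using x
  proof (cases rule: root_space_cases)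
    case 1
    then show ?thesis using T.subspace_0[OF subspace_overshear_submodule] by simp
  next
    case 2
    then have "rho x v = 0" using weight_spaceD[OF v] \<nu> by simp
    then show ?thesis by (intro overshear_in_overshear_submodule) simp
  next
    case 3
    then obtain f h where "root_triple \<alpha> x f h" using exists_root_triple[OF x] by blast
    then have triple: "sl2_triple x f h" and h: "- h \<in> H"
      using real_cartanD subspace_neg[OF subspace_H] unfolding root_triple_def by blast+
    have "br (- h) x = (- 2) *s x" using triple by (simp add: br_minus_left sl2_triple_def)
    then have "\<alpha> (- h) = - 2" using root_spaceD[OF x h] 3(1) by (metis scale_right_imp_eq)
    then have "rho (- h) v = sv 2 v" using weight_spaceD[OF v h] \<nu>[OF h] by simp
    then show ?thesis
      by (rule weight_two_tensor_in_overshear_submodule[OF sl2_triple_swap[OF triple]])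
  qed
qed

text \<open>Stripping off a summand \<open>\<beta>\<close> on whose coroot the weight is positive: modulo the overshears
  the lowering operator of \<open>\<beta>\<close> is injective on that weight space.\<close>

lemma tensor_weight_space_sum_list_subset:
  assumes "\<And>\<beta>. \<beta> \<in> set \<beta>s \<Longrightarrow> is_root \<beta>"
  shows "tensor_weight_space (sum_list \<beta>s) \<subseteq> overshear_submodule"
  using assms
proof (induction "length \<beta>s" arbitrary: \<beta>s rule: less_induct)
  case less
  show ?case
  proof (cases "\<exists>h\<in>H. sum_list \<beta>s h \<noteq> 0")
    case False
    then show ?thesis by (intro tensor_weight_space_zero_subset) blast
  next
    case True
    then obtain \<beta> e f h and r :: real where \<beta>: "\<beta> \<in> set \<beta>s" "root_triple \<beta> e f h"
        "sum_list \<beta>s h = of_real r" "r > 0"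
      using positive_summand less.prems by metis
    then have f: "f \<in> root_space (- \<beta>)" and h: "h \<in> H" and triple: "sl2_triple e f h"
      using real_cartanD unfolding root_triple_def by blast+
    have "sum_list \<beta>s + - \<beta> = sum_list (remove1 \<beta> \<beta>s)"
      using sum_list_map_remove1[OF \<beta>(1), of "\<lambda>x. x"] by simp
    moreover have "tensor_weight_space (sum_list (remove1 \<beta> \<beta>s)) \<subseteq> overshear_submodule"
      using less.prems \<beta>(1) length_pos_if_in_set[OF \<beta>(1)]
      by (intro less.hyps) (auto simp: length_remove1 dest: notin_set_remove1)
    ultimately have ft: "sigma f t \<in> overshear_submodule"
      if "t \<in> tensor_weight_space (sum_list \<beta>s)" for t
      using sigma_tensor_weight_space[OF f that] by auto
    interpret S: sl2_rep st Bt "sigma e" "sigma f" "sigma h" by (rule sl2_rep_sigma[OF triple])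
    show ?thesis
    proof
      fix t assume t: "t \<in> tensor_weight_space (sum_list \<beta>s)"
      show "t \<in> overshear_submodule"
      proof (rule S.lowering_injective_mod[OF subspace_overshear_submodule _ _ ft[OF t]])
        show "sigma h t = st (of_real r) t" using sigma_H_tensor_weight_space[OF h t] \<beta>(3) by simp
        show "of_real r + of_nat k \<noteq> (0 :: complex)" for k
          using \<beta>(4) by (simp add: complex_eq_iff)
      qed (simp_all add: sigma_overshear_submodule)
    qed
  qed
qed

lemma overshear_submodule_eq_UNIV:
  assumes "irreducible_module sv rho" "\<mu> \<in> root_lattice sg br H" "\<mu> \<in> weights H sv rho"
  shows "overshear_submodule = UNIV"
proof -
  have sums: "tensor_weight_space \<nu> \<subseteq> overshear_submodule" if "\<nu> \<in> root_sums" for \<nu>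
    using that tensor_weight_space_sum_list_subset unfolding root_sums_def by blast
  have "tp v x \<in> overshear_submodule" for v x
  proof (rule bilinear_span_into_subspace[OF lin_tp lin_tp_left subspace_overshear_submodule])
    show "v \<in> V.span (\<Union>\<nu>\<in>root_sums. weight_space \<nu>)"
      using span_weight_spaces assms root_lattice_subset_root_sums by blast
    show "x \<in> span (\<Union>\<beta>\<in>root_sums. root_space \<beta>)" by (simp add: span_root_spaces_root_sums)
    show "tp v x \<in> overshear_submodule"
      if vx: "v \<in> (\<Union>\<nu>\<in>root_sums. weight_space \<nu>)" "x \<in> (\<Union>\<beta>\<in>root_sums. root_space \<beta>)" for v x
    proof -
      obtain \<beta> \<nu> where "\<beta> \<in> root_sums" "x \<in> root_space \<beta>" "\<nu> \<in> root_sums" "v \<in> weight_space \<nu>"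
        using vx by blast
      then have "\<nu> + \<beta> \<in> root_sums" "tp v x \<in> tensor_weight_space (\<nu> + \<beta>)"
        by (simp_all add: add_in_root_sums tp_in_tensor_weight_space)
      then show ?thesis using sums by blast
    qed
  qed
  then have "T.span {tp v x |v x. True} \<subseteq> overshear_submodule"
    by (intro T.span_minimal subspace_overshear_submodule) auto
  then show ?thesis unfolding span_tp by blast
qed

end

theorem theorem5p2:
  fixes sg :: "complex \<Rightarrow> 'g::ab_group_add \<Rightarrow> 'g"
    and br :: "'g \<Rightarrow> 'g \<Rightarrow> 'g"
    and sv :: "complex \<Rightarrow> 'v::ab_group_add \<Rightarrow> 'v"
    and rho :: "'g \<Rightarrow> 'v \<Rightarrow> 'v"
    and H :: "'g set"
    and \<Delta> :: "('g \<Rightarrow> complex) set"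
    and \<mu> :: "'g \<Rightarrow> complex"
    and st :: "complex \<Rightarrow> 't::ab_group_add \<Rightarrow> 't"
    and tp :: "'v \<Rightarrow> 'g \<Rightarrow> 't"
    and sigma :: "'g \<Rightarrow> 't \<Rightarrow> 't"
  assumes "simple_lie_algebra sg br" and "fin_dim sg"
    and "lie_module sg br sv rho" and "fin_dim sv" and "irreducible_module sv rho"
    and "cartan_subalgebra sg br H" and "root_base sg br H \<Delta>"
    and "highest_weight sg br H \<Delta> sv rho \<mu>"
    and "\<mu> \<in> root_lattice sg br H"
    and "tensor_product sv sg st tp"
    and "\<forall>x. Vector_Spaces.linear st st (sigma x)"
    and "\<forall>x v y. sigma x (tp v y) = tp (rho x v) y + tp v (br x y)"
  shows "gen_submodule st sigma {tp v x | v x. rho x (rho x v) = 0} = UNIV"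
proof -
  obtain Bg where G: "complex_fd_operators sg Bg" using fin_dim_obtain_basis[OF assms(2)] .
  obtain Bv where V: "complex_fd_operators sv Bv" using fin_dim_obtain_basis[OF assms(4)] .
  obtain Bt where T: "complex_fd_operators st Bt"
    using fin_dim_obtain_basis[OF fin_dim_tensor_product[OF assms(4,2,10)]] .
  have "cartan_lie_algebra sg Bg br H"
    using G assms(1,6)
    by (intro cartan_lie_algebra.intro simple_fd_lie_algebra.intro fd_lie_algebra.intro
        cartan_lie_algebra_axioms.intro simple_fd_lie_algebra_axioms.intro
        fd_lie_algebra_axioms.intro)
       (simp_all add: simple_lie_algebra_def)
  then interpret overshear_module sg Bg br H sv Bv st Bt rho tp sigma
    using V T assms(3,10-12)
    by (intro overshear_module.intro overshear_module_axioms.intro)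
       (simp_all add: complex_fd_operators_def alg_closed_fd_operators_def)
  have "\<mu> \<in> weights H sv rho" using assms(8) unfolding highest_weight_def by blast
  then show ?thesis
    using overshear_submodule_eq_UNIV[OF assms(5,9)] unfolding overshear_submodule_def by blast
qed

end
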